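(* Let $0<a<b<\infty$, let $p>1$ and $\alpha\in\left(\frac1p,1\right]$. Let $u\in AC[a,b]$ satisfy $u(a)=0$ and $\partial^{\alpha}_{a+}u\in L^p(a,b)$, where $\partial^\alpha_{a+}$ is the left Caputo fractional derivative of order $\alpha$. Then $$\left\|\frac{u}{x}\right\|_{L^p(a,b)}\leq \frac{a^{-1}(b-a)^{\alpha}}{\left(\frac{\alpha p}{p-1}-\frac{1}{p-1}\right)^{\frac{p-1}{p}}\Gamma(\alpha)} \left\|\partial^{\alpha}_{a+}u\right\|_{L^p(a,b)}.$$
   Context: $AC[a,b]$ is the space of (real- or complex-valued) absolutely continuous functions on $[a,b]$, $x$ denotes the variable in $(a,b)$, and $\Gamma$ is the Euler gamma function. For $\alpha>0$ the left Riemann--Liouville integral is $I_{a+}^\alpha f(t)=\frac{1}{\Gamma(\alpha)}\int_a^t (t-s)^{\alpha-1}f(s)\,ds$, $t\in(a,b]$, and $I_{a+}^0 f=f$. For $0<\alpha\le 1$ and $f\in AC[a,b]$ the left Caputo fractional derivative is $\partial_{a+}^\alpha f(t)=I_{a+}^{1-\alpha}f'(t)$ (defined for almost every $t$); in particular $\partial_{a+}^1 f=f'$. *)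

theory Defs
  imports "HOL-Analysis.Analysis"
begin

text \<open>
  Scalar values range over a type of sort \<open>{real_normed_field, euclidean_space}\<close>. By the
  Gelfand--Mazur theorem these are exactly the reals and the complex numbers (up to isomorphism),
  so one statement covers both the real- and the complex-valued case.
\<close>

text \<open>
  The classical epsilon-delta notion; \<open>D\<close> is a finite family of pairwise disjoint open
  subintervals \<open>(c, d)\<close>, each given by its pair of endpoints. (The library constant
  \<open>absolutely_continuous\<close> is about measures.)
\<close>

definition absolutely_continuous_fun_on :: "real \<Rightarrow> real \<Rightarrow> (real \<Rightarrow> 'a::real_normed_vector) \<Rightarrow> bool"
  where "absolutely_continuous_fun_on a b f \<longleftrightarrow>
    (\<forall>\<epsilon>>0. \<exists>\<delta>>0. \<forall>D::(real \<times> real) set.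
       finite D \<longrightarrow>
       (\<forall>(c, d)\<in>D. a \<le> c \<and> c < d \<and> d \<le> b) \<longrightarrow>
       disjoint_family_on (\<lambda>(c, d). {c<..<d}) D \<longrightarrow>
       (\<Sum>(c, d)\<in>D. d - c) < \<delta> \<longrightarrow>
       (\<Sum>(c, d)\<in>D. norm (f d - f c)) < \<epsilon>)"

definition in_Lp :: "real \<Rightarrow> real set \<Rightarrow> (real \<Rightarrow> 'a::euclidean_space) \<Rightarrow> bool"
  where "in_Lp p S f \<longleftrightarrow>
    f \<in> borel_measurable (lebesgue_on S) \<and>
    integrable (lebesgue_on S) (\<lambda>x. norm (f x) powr p)"

text \<open>Only meaningful for functions in the corresponding space \<open>in_Lp p S\<close>.\<close>

definition Lp_norm :: "real \<Rightarrow> real set \<Rightarrow> (real \<Rightarrow> 'a::euclidean_space) \<Rightarrow> real"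
  where "Lp_norm p S f = (LINT x|lebesgue_on S. norm (f x) powr p) powr (1 / p)"

definition RL_integral :: "real \<Rightarrow> real \<Rightarrow> (real \<Rightarrow> 'a::euclidean_space) \<Rightarrow> real \<Rightarrow> 'a"
  where "RL_integral a \<alpha> f t =
    (if \<alpha> = 0 then f t
     else (1 / Gamma \<alpha>) *\<^sub>R (LINT s|lebesgue_on {a<..<t}. ((t - s) powr (\<alpha> - 1)) *\<^sub>R f s))"

text \<open>
  Intended for \<open>0 < \<alpha> \<le> 1\<close> and \<open>f\<close> absolutely continuous, hence differentiable almost everywhere.
  On the exceptional null sets (where \<open>f\<close> is not differentiable, or where the fractional integral
  does not converge) the value is an irrelevant default.
\<close>

definition caputo_deriv :: "real \<Rightarrow> real \<Rightarrow> (real \<Rightarrow> 'a::euclidean_space) \<Rightarrow> real \<Rightarrow> 'a"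
  where "caputo_deriv a \<alpha> f = RL_integral a (1 - \<alpha>) (\<lambda>s. vector_derivative f (at s))"

end

theory Submission
  imports Defs
begin

text \<open>
  Since \<open>u\<close> is absolutely continuous with \<open>u a = 0\<close>, it is the integral of its a.e. derivative, and
  Fubini's theorem together with the Beta integral turns this into
  \<open>\<Gamma>(\<alpha>) u(t) = \<integral>\<^sub>a\<^sup>t (t - x)\<^bsup>\<alpha>-1\<^esup> \<partial>\<^sup>\<alpha>u(x) dx\<close>. Hoelder's inequality, whose kernel factor is finite
  exactly because \<open>\<alpha> > 1/p\<close>, bounds \<open>|u(t)|\<close> by a multiple of \<open>(t - a)\<^bsup>\<alpha>-1/p\<^esup>\<close>; estimating \<open>1/t\<close> by
  \<open>1/a\<close> and integrating over \<open>(a, b)\<close> gives the claim.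

  The a.e. differentiability comes from Austin's proof of Lebesgue's theorem on functions of bounded
  variation, and the fundamental theorem of calculus from the gauge integral.
\<close>

section \<open>Differentiability of functions of bounded variation\<close>

text \<open>The derivative u' exists only almost everywhere, and absolute continuity controls
  variation only on short intervals. Differentiability and absolute integrability of u' are
  therefore proved on short subintervals and glued by bisection. With the gauge integral,
  integrability of u' comes out of the fundamental theorem instead of going into it.

  The identity for u is the semigroup law I^\<alpha> I^{1-\<alpha>} = I^1 applied to u': once the
  integrals are exchanged, the kernel between s and t integrates to \<Gamma>(\<alpha>)
  \<Gamma>(1-\<alpha>), whatever s < t are. Two obstacles shape its proof. Fubini's theorem is
  applied over \<open>lborel\<close>, whereas u' is only Lebesgue measurable, so a Borel
  representative takes its place without changing any inner integral. And \<Gamma> has a pole at 0,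
  so the order \<alpha> = 1 is treated separately.

  The constant is not sharp: the pointwise bound is replaced by its value at t = b before
  integrating. Integrating (t - a)^(\<alpha> p - 1) itself would give a further factor (\<alpha>
  p)^(-1/p).\<close>

text \<open>The conditions are those that \<open>absolutely_continuous_fun_on\<close> puts on its
  families, so bounded variation, Vitali selections and absolute continuity are all tested on the
  same objects. Neighbours may share an endpoint.\<close>

definition interval_family :: "real \<Rightarrow> real \<Rightarrow> (real \<times> real) set \<Rightarrow> bool"
  where "interval_family c d D \<longleftrightarrow> finite D \<and> (\<forall>(x, y)\<in>D. c \<le> x \<and> x < y \<and> y \<le> d) \<and>
    disjoint_family_on (\<lambda>(x, y). {x<..<y}) D"

lemma disjoint_open_intervals_iff:
  fixes x y x' y' :: real
  assumes "x < y" "x' < y'"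
  shows "{x<..<y} \<inter> {x'<..<y'} = {} \<longleftrightarrow> y \<le> x' \<or> y' \<le> x"
proof
  assume *: "{x<..<y} \<inter> {x'<..<y'} = {}"
  show "y \<le> x' \<or> y' \<le> x"
  proof (rule ccontr)
    assume "\<not> ?thesis"
    with assms have "max x x' < min y y'" by auto
    then obtain z where "max x x' < z" "z < min y y'" using dense by blast
    then have "z \<in> {x<..<y} \<inter> {x'<..<y'}" by auto
    with * show False by blast
  qed
qed auto

lemma interval_family_iff:
  "interval_family c d D \<longleftrightarrow> finite D \<and> (\<forall>(x, y)\<in>D. c \<le> x \<and> x < y \<and> y \<le> d) \<and>
    (\<forall>(x, y)\<in>D. \<forall>(x', y')\<in>D. (x, y) \<noteq> (x', y') \<longrightarrow> y \<le> x' \<or> y' \<le> x)"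
proof -
  have "disjoint_family_on (\<lambda>(x, y). {x<..<y}) D \<longleftrightarrow>
    (\<forall>(x, y)\<in>D. \<forall>(x', y')\<in>D. (x, y) \<noteq> (x', y') \<longrightarrow> y \<le> x' \<or> y' \<le> x)"
    if "\<forall>(x, y)\<in>D. x < y"
    unfolding disjoint_family_on_def
    using that disjoint_open_intervals_iff by (smt (verit, best) case_prod_unfold prod.collapse)
  then show ?thesis unfolding interval_family_def by (auto simp: case_prod_unfold)
qed

lemma interval_familyI:
  assumes "finite D"
    and "\<And>x y. (x, y) \<in> D \<Longrightarrow> c \<le> x \<and> x < y \<and> y \<le> d"
    and "\<And>x y x' y'. (x, y) \<in> D \<Longrightarrow> (x', y') \<in> D \<Longrightarrow> (x, y) \<noteq> (x', y') \<Longrightarrow> y \<le> x' \<or> y' \<le> x"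
  shows "interval_family c d D"
  unfolding interval_family_iff using assms by fast

lemma interval_familyD:
  assumes "interval_family c d D"
  shows "finite D"
    and "\<And>x y. (x, y) \<in> D \<Longrightarrow> c \<le> x \<and> x < y \<and> y \<le> d"
    and "\<And>x y x' y'. (x, y) \<in> D \<Longrightarrow> (x', y') \<in> D \<Longrightarrow> (x, y) \<noteq> (x', y') \<Longrightarrow> y \<le> x' \<or> y' \<le> x"
  using assms unfolding interval_family_iff by fast+

lemma interval_family_mono:
  assumes "interval_family c d D" "c' \<le> c" "d \<le> d'"
  shows "interval_family c' d' D"
  using assms unfolding interval_family_def by fastforce

text \<open>The Vitali covering lemma selects pairwise disjoint closed balls; this turns such a
  selection into an \<open>interval_family\<close>.\<close>

lemma interval_family_if_disjnt:
  assumes "finite P" and P: "\<And>x y. (x, y) \<in> P \<Longrightarrow> c \<le> x \<and> x < y \<and> y \<le> d"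
    and disj: "pairwise (\<lambda>i j. disjnt {fst i..snd i} {fst j..snd j}) P"
  shows "interval_family c d P"
proof (rule interval_familyI)
  show "finite P" by fact
  show "c \<le> x \<and> x < y \<and> y \<le> d" if "(x, y) \<in> P" for x y by (rule P[OF that])
  fix x y x' y' assume *: "(x, y) \<in> P" "(x', y') \<in> P" "(x, y) \<noteq> (x', y')"
  have "{x..y} \<inter> {x'..y'} = {}" using pairwiseD[OF disj *] by (simp add: disjnt_def)
  then have "{x<..<y} \<inter> {x'<..<y'} = {}"
    using greaterThanLessThan_subseteq_atLeastAtMost_iff by blast
  then show "y \<le> x' \<or> y' \<le> x" using disjoint_open_intervals_iff P * by blast
qed

text \<open>Divisions for the gauge integral may contain degenerate intervals, which an
  \<open>interval_family\<close> excludes. Dropping them keeps the sum because \<open>g\<close>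
  vanishes on the diagonal. Equal nondegenerate intervals with different indices would overlap, so
  passing from indices to pairs loses no summand.\<close>

lemma interval_family_of_indexed:
  fixes l m :: "'i \<Rightarrow> real"
  assumes "finite I" and I: "\<And>i. i \<in> I \<Longrightarrow> c \<le> l i \<and> l i \<le> m i \<and> m i \<le> d"
    and disj: "\<And>i j. i \<in> I \<Longrightarrow> j \<in> I \<Longrightarrow> i \<noteq> j \<Longrightarrow> {l i<..<m i} \<inter> {l j<..<m j} = {}"
  obtains D where "interval_family c d D" "D \<subseteq> (\<lambda>i. (l i, m i)) ` I"
    "\<And>g :: real \<Rightarrow> real \<Rightarrow> real. (\<And>x. g x x = 0) \<Longrightarrow> (\<Sum>i\<in>I. g (l i) (m i)) = (\<Sum>(x, y)\<in>D. g x y)"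
proof
  define J where "J = {i \<in> I. l i < m i}"
  have inj: "inj_on (\<lambda>i. (l i, m i)) J"
  proof (rule inj_onI)
    fix i j assume *: "i \<in> J" "j \<in> J" "(l i, m i) = (l j, m j)"
    then show "i = j" using disj[of i j] by (auto simp: J_def)
  qed
  show "interval_family c d ((\<lambda>i. (l i, m i)) ` J)"
  proof (rule interval_familyI)
    show "y \<le> x' \<or> y' \<le> x" if xy: "(x, y) \<in> (\<lambda>i. (l i, m i)) ` J" "(x', y') \<in> (\<lambda>i. (l i, m i)) ` J"
      "(x, y) \<noteq> (x', y')" for x y x' y'
    proof -
      obtain i j where "i \<in> I" "l i < m i" "j \<in> I" "l j < m j"
        "(x, y) = (l i, m i)" "(x', y') = (l j, m j)"
        using xy by (auto simp: J_def)
      then show ?thesis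
        using xy(3) disj[of i j] disjoint_open_intervals_iff[of x y x' y'] by auto
    qed
  qed (use I \<open>finite I\<close> in \<open>auto simp: J_def\<close>)
  show "(\<lambda>i. (l i, m i)) ` J \<subseteq> (\<lambda>i. (l i, m i)) ` I" by (auto simp: J_def)
  fix g :: "real \<Rightarrow> real \<Rightarrow> real" assume g: "\<And>x. g x x = 0"
  have "(\<Sum>i\<in>I. g (l i) (m i)) = (\<Sum>i\<in>J. g (l i) (m i))"
  proof (rule sum.mono_neutral_right)
    show "\<forall>i\<in>I - J. g (l i) (m i) = 0"
    proof
      fix i assume "i \<in> I - J"
      then have "l i = m i" using I[of i] by (auto simp: J_def)
      then show "g (l i) (m i) = 0" by (simp add: g)
    qed
  qed (use \<open>finite I\<close> in \<open>auto simp: J_def\<close>)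
  then show "(\<Sum>i\<in>I. g (l i) (m i)) = (\<Sum>(x, y)\<in>(\<lambda>i. (l i, m i)) ` J. g x y)"
    using inj by (simp add: sum.reindex)
qed

text \<open>\<open>R\<close> fills the gaps, so that increments telescope over the whole family. The
  induction removes the rightmost interval, completes the rest up to its left endpoint and adds the
  last gap if it is nonempty; hence \<open>d\<close> stays arbitrary.\<close>

lemma interval_family_complete:
  assumes "interval_family c d P" "c \<le> d"
  obtains R where "P \<inter> R = {}" "interval_family c d (P \<union> R)"
    "{c<..<d} \<subseteq> (\<Union>(x, y)\<in>P \<union> R. {x..y})"
    "\<And>f :: real \<Rightarrow> real. (\<Sum>(x, y)\<in>P \<union> R. f y - f x) = f d - f c"
proof -
  have "finite P" using assms by (simp add: interval_family_def)
  then have "\<exists>R. P \<inter> R = {} \<and> interval_family c d (P \<union> R) \<and>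
    {c<..<d} \<subseteq> (\<Union>(x, y)\<in>P \<union> R. {x..y}) \<and>
    (\<forall>f :: real \<Rightarrow> real. (\<Sum>(x, y)\<in>P \<union> R. f y - f x) = f d - f c)"
    using assms
  proof (induction P arbitrary: d rule: finite_psubset_induct)
    case (psubset P d)
    show ?case
    proof (cases "P = {}")
      case True
      show ?thesis
      proof (cases "c = d")
        case True
        with \<open>P = {}\<close> show ?thesis
          by (intro exI[of _ "{}"]) (auto simp: interval_family_iff)
      next
        case False
        with \<open>P = {}\<close> psubset.prems show ?thesis
          by (intro exI[of _ "{(c, d)}"]) (auto simp: interval_family_iff)
      qed
    next
      case False
      have "Max (snd ` P) \<in> snd ` P" using False psubset.hyps by simp
      then obtain x y where xy: "(x, y) \<in> P" "y = Max (snd ` P)" by force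
      have ymax: "y' \<le> y" if "(x', y') \<in> P" for x' y'
        using that xy(2) psubset.hyps by (simp add: rev_image_eqI)
      note fam = interval_familyD[OF psubset.prems(1)]
      define P' where "P' = P - {(x, y)}"
      have xyb: "c \<le> x" "x < y" "y \<le> d" using fam(2)[OF xy(1)] by auto
      have left: "y' \<le> x" if "(x', y') \<in> P'" for x' y'
        using fam(2)[of x' y'] fam(3)[OF xy(1), of x' y'] ymax[of x' y'] that
        unfolding P'_def by force
      have "interval_family c x P'"
        using fam left by (intro interval_familyI) (auto simp: P'_def)
      moreover have "P' \<subset> P" using xy(1) by (auto simp: P'_def)
      ultimately obtain R' where R': "P' \<inter> R' = {}" "interval_family c x (P' \<union> R')"
        "{c<..<x} \<subseteq> (\<Union>(x, y)\<in>P' \<union> R'. {x..y})"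
        "\<And>f :: real \<Rightarrow> real. (\<Sum>(x, y)\<in>P' \<union> R'. f y - f x) = f x - f c"
        using psubset.IH[of P' x] xyb(1) by metis
      note fam' = interval_familyD[OF R'(2)]
      define L where "L = (if y = d then {} else {(y, d)})"
      define R where "R = R' \<union> L"
      have PR: "P \<union> R = (P' \<union> R') \<union> insert (x, y) L"
        using xy(1) by (auto simp: P'_def R_def)
      have LD: "u = y \<and> v = d \<and> y < d" if "(u, v) \<in> L" for u v
        using that xyb by (auto simp: L_def split: if_splits)
      have disj: "(P' \<union> R') \<inter> insert (x, y) L = {}" "(x, y) \<notin> L"
        using fam'(2) LD xyb by fastforce+
      show ?thesis
      proof (intro exI[of _ R] conjI allI)
        have "P \<inter> L = {}" using ymax LD by fastforce
        moreover have "(x, y) \<notin> R'" using disj(1) by blast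
        ultimately show "P \<inter> R = {}"
          using R'(1) unfolding R_def P'_def by blast
        show "interval_family c d (P \<union> R)"
        proof (rule interval_familyI)
          show "finite (P \<union> R)" unfolding PR using fam'(1) by (auto simp: L_def)
          show "c \<le> u \<and> u < v \<and> v \<le> d" if "(u, v) \<in> P \<union> R" for u v
            using that fam'(2)[of u v] LD[of u v] xyb unfolding PR by auto
          show "v \<le> u' \<or> v' \<le> u"
            if "(u, v) \<in> P \<union> R" "(u', v') \<in> P \<union> R" "(u, v) \<noteq> (u', v')" for u v u' v'
            using that fam'(2)[of u v] LD[of u v] fam'(2)[of u' v'] LD[of u' v'] xyb
              fam'(3)[of u v u' v'] unfolding PR by auto
        qed
        show "{c<..<d} \<subseteq> (\<Union>(x, y)\<in>P \<union> R. {x..y})"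
        proof
          fix z assume z: "z \<in> {c<..<d}"
          consider "z < x" | "x \<le> z" "z \<le> y" | "y < z" by linarith
          then show "z \<in> (\<Union>(x, y)\<in>P \<union> R. {x..y})"
          proof cases
            case 1
            with z have "z \<in> {c<..<x}" by auto
            then show ?thesis using R'(3) unfolding PR by blast
          next
            case 2
            then show ?thesis unfolding PR by auto
          next
            case 3
            with z show ?thesis unfolding PR L_def by auto
          qed
        qed
        fix f :: "real \<Rightarrow> real"
        have "finite (P' \<union> R')" "finite L" using fam'(1) by (auto simp: L_def)
        then have "(\<Sum>(x, y)\<in>P \<union> R. f y - f x)
          = (\<Sum>(x, y)\<in>P' \<union> R'. f y - f x) + (\<Sum>(x, y)\<in>insert (x, y) L. f y - f x)"
          unfolding PR using disj by (subst sum.union_disjoint) auto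
        also have "\<dots> = f x - f c + (f y - f x + (\<Sum>(x, y)\<in>L. f y - f x))"
          using disj(2) \<open>finite L\<close> R'(4)[of f] by simp
        also have "(\<Sum>(x, y)\<in>L. f y - f x) = f d - f y"
          by (auto simp: L_def)
        finally show "(\<Sum>(x, y)\<in>P \<union> R. f y - f x) = f d - f c" by simp
      qed
    qed
  qed
  then show thesis using that by blast
qed

lemma interval_family_length_le:
  assumes "interval_family c d P" "c \<le> d"
  shows "(\<Sum>(x, y)\<in>P. y - x) \<le> d - c"
proof -
  obtain R where R: "P \<inter> R = {}" "interval_family c d (P \<union> R)"
    "\<And>f :: real \<Rightarrow> real. (\<Sum>(x, y)\<in>P \<union> R. f y - f x) = f d - f c"
    using interval_family_complete[OF assms] by metis
  have "(\<Sum>(x, y)\<in>P. y - x) \<le> (\<Sum>(x, y)\<in>P \<union> R. y - x)"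
    using interval_familyD[OF R(2)] by (intro sum_mono2) force+
  also have "\<dots> = d - c" using R(3)[of "\<lambda>x. x"] .
  finally show ?thesis .
qed

text \<open>Refinement of \<open>D\<close> by a family inside each member. The sums add up because
  all intervals have positive length, so no pair belongs to the families of two different
  members.\<close>

lemma interval_family_UN:
  assumes D: "interval_family c d D"
    and Q: "\<And>x y. (x, y) \<in> D \<Longrightarrow> interval_family x y (Q (x, y))"
  shows "interval_family c d (\<Union>i\<in>D. Q i)"
    and "(\<Sum>j\<in>(\<Union>i\<in>D. Q i). g j) = (\<Sum>i\<in>D. \<Sum>j\<in>Q i. (g j :: real))"
proof -
  note famD = interval_familyD[OF D]
  note famQ = interval_familyD[OF Q]
  show "interval_family c d (\<Union>i\<in>D. Q i)"
  proof (rule interval_familyI)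
    show "finite (\<Union>i\<in>D. Q i)" using famD(1) famQ(1) by auto
    fix u v assume "(u, v) \<in> (\<Union>i\<in>D. Q i)"
    then obtain x y where xy: "(x, y) \<in> D" "(u, v) \<in> Q (x, y)" by auto
    then have uv: "x \<le> u \<and> u < v \<and> v \<le> y" using famQ(2) by blast
    show "c \<le> u \<and> u < v \<and> v \<le> d" using uv famD(2)[OF xy(1)] by linarith
    fix u' v' assume "(u', v') \<in> (\<Union>i\<in>D. Q i)" and ne: "(u, v) \<noteq> (u', v')"
    then obtain x' y' where xy': "(x', y') \<in> D" "(u', v') \<in> Q (x', y')" by auto
    then have uv': "x' \<le> u' \<and> u' < v' \<and> v' \<le> y'" using famQ(2) by blast
    show "v \<le> u' \<or> v' \<le> u"
    proof (cases "(x, y) = (x', y')")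
      case True
      then show ?thesis using famQ(3)[OF xy(1) xy(2) _ ne] xy'(2) by simp
    next
      case False
      then show ?thesis using famD(3)[OF xy(1) xy'(1)] uv uv' by linarith
    qed
  qed
  show "(\<Sum>j\<in>(\<Union>i\<in>D. Q i). g j) = (\<Sum>i\<in>D. \<Sum>j\<in>Q i. g j)"
  proof (rule sum.UNION_disjoint)
    show "finite D" by (rule famD(1))
    show "\<forall>i\<in>D. finite (Q i)" using famQ(1) by auto
    show "\<forall>i\<in>D. \<forall>j\<in>D. i \<noteq> j \<longrightarrow> Q i \<inter> Q j = {}"
    proof (intro ballI impI)
      fix i j assume ij: "i \<in> D" "j \<in> D" "i \<noteq> j"
      obtain x y x' y' where e: "i = (x, y)" "j = (x', y')" by (cases i, cases j) auto
      show "Q i \<inter> Q j = {}"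
        using famD(3)[of x y x' y'] famQ(2)[of x y] famQ(2)[of x' y'] ij unfolding e
        by fastforce
    qed
  qed
qed

section \<open>Vitali coverings and exceptional slopes\<close>

text \<open>Vitali's lemma selects disjoint intervals from \<open>K\<close> whose fivefold
  enlargements cover \<open>E\<close>. Finitely many of them have total length at most
  \<open>M\<close>, and the bound 5 * \<open>M\<close> survives the countable union. Nothing is
  known about measurability of \<open>E\<close>, so the bound concerns an outer set
  \<open>T\<close>.\<close>

lemma Vitali_intervals_bound:
  fixes E :: "real set"
  assumes cover: "E \<subseteq> (\<Union>(l, m)\<in>K. {l..m})"
    and K: "\<And>l m. (l, m) \<in> K \<Longrightarrow> l < m \<and> m - l \<le> B"
    and M: "\<And>P. finite P \<Longrightarrow> P \<subseteq> K \<Longrightarrow>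
      pairwise (\<lambda>i j. disjnt {fst i..snd i} {fst j..snd j}) P \<Longrightarrow> (\<Sum>(l, m)\<in>P. m - l) \<le> M"
  shows "\<exists>T. E \<subseteq> T \<and> T \<in> lmeasurable \<and> measure lebesgue T \<le> 5 * M"
proof -
  define z r where "z = (\<lambda>i::real \<times> real. (fst i + snd i) / 2)"
    and "r = (\<lambda>i::real \<times> real. (snd i - fst i) / 2)"
  have cb: "cball (z i) (r i) = {fst i..snd i}" for i
    by (auto simp: cball_eq_atLeastAtMost z_def r_def field_simps)
  have cov: "E \<subseteq> (\<Union>i\<in>K. cball (z i) (r i))"
    using cover unfolding cb by (auto simp: case_prod_unfold)
  have rB: "0 < r i \<and> r i \<le> B" if "i \<in> K" for i
    using K[of "fst i" "snd i"] that by (auto simp: r_def)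
  obtain C where C: "countable C" "C \<subseteq> K"
    "pairwise (\<lambda>i j. disjnt (cball (z i) (r i)) (cball (z j) (r j))) C"
    "E \<subseteq> (\<Union>i\<in>C. cball (z i) (5 * r i))"
    by (rule Vitali_covering_lemma_cballs[OF cov rB])
  have bound: "measure lebesgue (\<Union>i\<in>J. cball (z i) (5 * r i)) \<le> 5 * M"
    if J: "J \<subseteq> C" "finite J" for J
  proof -
    have "measure lebesgue (\<Union>i\<in>J. cball (z i) (5 * r i))
      \<le> (\<Sum>i\<in>J. measure lebesgue (cball (z i) (5 * r i)))"
      using J by (intro measure_UNION_le) auto
    also have "\<dots> = (\<Sum>i\<in>J. 5 * (snd i - fst i))"
    proof (rule sum.cong)
      fix i assume "i \<in> J"
      then have "fst i < snd i" using K[of "fst i" "snd i"] J C(2) by auto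
      then show "measure lebesgue (cball (z i) (5 * r i)) = 5 * (snd i - fst i)"
        by (simp add: cball_eq_atLeastAtMost r_def field_simps)
    qed auto
    also have "\<dots> = 5 * (\<Sum>(l, m)\<in>J. m - l)"
      by (simp add: sum_distrib_left case_prod_unfold)
    also have "\<dots> \<le> 5 * M"
      using M[of J] J C(2) pairwise_subset[OF C(3) J(1)] unfolding cb by auto
    finally show ?thesis .
  qed
  have "(\<Union>i\<in>C. cball (z i) (5 * r i)) \<in> lmeasurable"
    by (rule fmeasurable_UN_bound[OF C(1) _ bound]) auto
  moreover have "measure lebesgue (\<Union>i\<in>C. cball (z i) (5 * r i)) \<le> 5 * M"
    by (rule measure_UN_bound[OF C(1) _ bound]) auto
  ultimately show ?thesis using C(4) by blast
qed

text \<open>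
  Austin's argument: refining a family of almost maximal variation by disjoint intervals on which
  the slope has the opposite sign increases the variation by a multiple of their total length.
\<close>

lemma negligible_opposite_slopes:
  fixes h :: "real \<Rightarrow> real"
  assumes BV: "\<And>D. interval_family c d D \<Longrightarrow> (\<Sum>(x, y)\<in>D. \<bar>h y - h x\<bar>) \<le> B"
    and "c \<le> d" "r > 0" and E: "E \<subseteq> {c<..<d}"
    and up: "\<And>x \<delta>. x \<in> E \<Longrightarrow> \<delta> > 0 \<Longrightarrow>
      \<exists>l m. l < m \<and> x \<in> {l..m} \<and> m - l < \<delta> \<and> h m - h l > r * (m - l)"
    and dn: "\<And>x \<delta>. x \<in> E \<Longrightarrow> \<delta> > 0 \<Longrightarrow>
      \<exists>l m. l < m \<and> x \<in> {l..m} \<and> m - l < \<delta> \<and> h m - h l < - r * (m - l)"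
  shows "negligible E"
  unfolding negligible_outer_le
proof (intro allI impI)
  fix e :: real assume "e > 0"
  define var where "var D = (\<Sum>(x, y)\<in>D. \<bar>h y - h x\<bar>)" for D
  define V where "V = (SUP D\<in>{D. interval_family c d D}. var D)"
  have bdd: "bdd_above (var ` {D. interval_family c d D})"
    using BV by (auto intro!: bdd_aboveI[of _ B] simp: var_def)
  have V: "var D \<le> V" if "interval_family c d D" for D
    unfolding V_def using that bdd by (intro cSUP_upper) auto
  \<comment> \<open>The 5 is the Vitali enlargement, and 2 * \<open>r\<close> is the variation
    gained below per unit of length; with this choice the final bound is exactly
    \<open>e\<close>.\<close>
  define \<epsilon> where "\<epsilon> = 2 * r * e / 5"
  have "\<epsilon> > 0" using \<open>e > 0\<close> \<open>r > 0\<close> by (simp add: \<epsilon>_def)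
  have "interval_family c d {}" by (simp add: interval_family_iff)
  then obtain D0 where D0: "interval_family c d D0" "var D0 > V - \<epsilon>"
    using less_cSUP_iff[OF _ bdd, of "V - \<epsilon>"] \<open>\<epsilon> > 0\<close> unfolding V_def by auto
  \<comment> \<open>Completing \<open>D0\<close> does not lower its variation and makes the members
    cover {c<..<d}, so each point of \<open>E\<close> outside the finite set of endpoints lies
    strictly inside a member.\<close>
  obtain R where R: "D0 \<inter> R = {}" "interval_family c d (D0 \<union> R)"
    "{c<..<d} \<subseteq> (\<Union>(x, y)\<in>D0 \<union> R. {x..y})"
    using interval_family_complete[OF D0(1) \<open>c \<le> d\<close>] by metis
  define D where "D = D0 \<union> R"
  note D = R(2)[folded D_def]
  note famD = interval_familyD[OF D]
  have "var D0 \<le> var D"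
    unfolding var_def D_def using interval_familyD(1)[OF R(2)] by (intro sum_mono2) auto
  then have varD: "var D > V - \<epsilon>" using D0(2) by linarith
  define F where "F = fst ` D \<union> snd ` D"
  have "finite F" using famD(1) by (simp add: F_def)
  \<comment> \<open>Intervals inside a member of \<open>D\<close> on which \<open>h\<close> moves
    against its increment over that member. The length bound 1 supplies the bounded radii for
    Vitali's lemma.\<close>
  define K where "K = {(l, m). l < m \<and> m - l \<le> 1 \<and> (\<exists>(x, y)\<in>D. x \<le> l \<and> m \<le> y \<and>
    (if h x \<le> h y then h m - h l < - r * (m - l) else h m - h l > r * (m - l)))}"
  have "\<exists>T. E - F \<subseteq> T \<and> T \<in> lmeasurable \<and> measure lebesgue T \<le> 5 * (\<epsilon> / (2 * r))"
  proof (rule Vitali_intervals_bound)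
    show "E - F \<subseteq> (\<Union>(l, m)\<in>K. {l..m})"
    proof
      fix x assume x: "x \<in> E - F"
      then have "x \<in> {c<..<d}" using E by auto
      then obtain u v where uv: "(u, v) \<in> D" "u \<le> x" "x \<le> v"
        using R(3) unfolding D_def by fastforce
      then have "u \<in> F" "v \<in> F" unfolding F_def by force+
      then have "x \<noteq> u" "x \<noteq> v" using x by auto
      define \<delta> where "\<delta> = min 1 (min (x - u) (v - x))"
      have "\<delta> > 0" using uv \<open>x \<noteq> u\<close> \<open>x \<noteq> v\<close> by (auto simp: \<delta>_def)
      obtain l m where lm: "l < m" "x \<in> {l..m}" "m - l < \<delta>"
        "if h u \<le> h v then h m - h l < - r * (m - l) else h m - h l > r * (m - l)"
      proof (cases "h u \<le> h v")
        case True
        then show ?thesis using dn[of x \<delta>] x \<open>\<delta> > 0\<close> that by (metis DiffE)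
      next
        case False
        then show ?thesis using up[of x \<delta>] x \<open>\<delta> > 0\<close> that by (metis DiffE)
      qed
      have "(l, m) \<in> K"
        unfolding K_def using lm uv by (auto simp: \<delta>_def intro!: bexI[of _ "(u, v)"])
      then show "x \<in> (\<Union>(l, m)\<in>K. {l..m})" using lm(2) by blast
    qed
    show "l < m \<and> m - l \<le> 1" if "(l, m) \<in> K" for l m
      using that by (auto simp: K_def)
    fix P assume P: "finite P" "P \<subseteq> K"
      "pairwise (\<lambda>i j. disjnt {fst i..snd i} {fst j..snd j}) P"
    define S where "S = (\<lambda>(x, y). {(l, m)\<in>P. x \<le> l \<and> m \<le> y})"
    have Sfam: "interval_family x y (S (x, y))" for x y
    proof (rule interval_family_if_disjnt)
      show "finite (S (x, y))" using P(1) by (auto simp: S_def intro: finite_subset)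
      show "x \<le> l \<and> l < m \<and> m \<le> y" if "(l, m) \<in> S (x, y)" for l m
        using that P(2) by (auto simp: S_def K_def)
      show "pairwise (\<lambda>i j. disjnt {fst i..snd i} {fst j..snd j}) (S (x, y))"
        by (rule pairwise_subset[OF P(3)]) (auto simp: S_def)
    qed
    have "\<exists>Q. \<forall>i\<in>D. interval_family (fst i) (snd i) (Q i) \<and>
      var (Q i) \<ge> \<bar>h (snd i) - h (fst i)\<bar> + 2 * r * (\<Sum>(l, m)\<in>S i. m - l)"
    proof (intro bchoice ballI)
      fix i assume i: "i \<in> D"
      obtain x y where xy: "i = (x, y)" by (cases i)
      have "x < y" using famD(2) i xy by auto
      obtain R' where R': "S i \<inter> R' = {}" "interval_family x y (S i \<union> R')"
        "\<And>f :: real \<Rightarrow> real. (\<Sum>(x, y)\<in>S i \<union> R'. f y - f x) = f y - f x"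
        using interval_family_complete[OF Sfam[of x y]] i \<open>x < y\<close> unfolding xy
        by (metis less_imp_le)
      have fin: "finite (S i)" "finite R'" using interval_familyD(1)[OF R'(2)] by auto
      have sgn: "(if h x \<le> h y then h m - h l < - r * (m - l) else h m - h l > r * (m - l))"
        if "(l, m) \<in> S i" for l m
      proof -
        have lm: "(l, m) \<in> K" "x \<le> l" "m \<le> y" using that P(2) by (auto simp: S_def xy)
        then obtain x' y' where xy': "(x', y') \<in> D" "x' \<le> l" "m \<le> y'" "l < m"
          "if h x' \<le> h y' then h m - h l < - r * (m - l) else h m - h l > r * (m - l)"
          by (auto simp: K_def)
        \<comment> \<open>\<open>K\<close> only provides some member of \<open>D\<close> around (l,
          m); as members do not overlap and l < m, it is the one at hand.\<close>
        have "(x', y') = (x, y)"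
          using famD(3)[OF xy'(1), of x y] i xy' lm unfolding xy by fastforce
        then show ?thesis using xy'(5) by simp
      qed
      \<comment> \<open>The increments over \<open>S i\<close> all oppose h y - h x, so
        \<open>R'\<close> has to make up for them: its variation is at least |h y - h x| +
        \<open>var (S i)\<close>. Adding the variation of \<open>S i\<close> itself, the refinement
        gains 2 * \<open>var (S i)\<close>, hence at least 2 * \<open>r\<close> times the length of
        \<open>S i\<close>.\<close>
      have "(\<Sum>(l, m)\<in>S i. h m - h l) + (\<Sum>(l, m)\<in>R'. h m - h l) = h y - h x"
        using R'(3)[of h] sum.union_disjoint[OF fin R'(1)] by metis
      moreover have "\<bar>\<Sum>(l, m)\<in>R'. h m - h l\<bar> \<le> var R'"
        unfolding var_def by (rule order_trans[OF sum_abs]) (simp add: case_prod_unfold)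
      moreover have "var (S i \<union> R') = var (S i) + var R'"
        unfolding var_def using sum.union_disjoint[OF fin R'(1)] .
      moreover have "var (S i) = (if h x \<le> h y then - (\<Sum>(l, m)\<in>S i. h m - h l)
          else (\<Sum>(l, m)\<in>S i. h m - h l))"
      proof -
        have "\<bar>h m - h l\<bar> = (if h x \<le> h y then - (h m - h l) else h m - h l)"
          if "(l, m) \<in> S i" for l m
        proof -
          have "r * (m - l) > 0" using that \<open>r > 0\<close> P(2) by (auto simp: S_def xy K_def)
          then show ?thesis using sgn[OF that] by (auto split: if_splits)
        qed
        then show ?thesis
          unfolding var_def
          by (auto simp: case_prod_unfold simp flip: sum_negf intro!: sum.cong)
      qed
      moreover have "var (S i) \<ge> r * (\<Sum>(l, m)\<in>S i. m - l)"
        unfolding var_def sum_distrib_left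
      proof (rule sum_mono, clarify)
        fix l m assume "(l, m) \<in> S i"
        from sgn[OF this] show "r * (m - l) \<le> \<bar>h m - h l\<bar>" by (auto split: if_splits)
      qed
      ultimately have "var (S i \<union> R') \<ge> \<bar>h y - h x\<bar> + 2 * r * (\<Sum>(l, m)\<in>S i. m - l)"
        by (auto split: if_splits)
      then show "\<exists>Q. interval_family (fst i) (snd i) Q \<and>
        var Q \<ge> \<bar>h (snd i) - h (fst i)\<bar> + 2 * r * (\<Sum>(l, m)\<in>S i. m - l)"
        using R'(2) unfolding xy by auto
    qed
    then obtain Q where Qall: "\<forall>i\<in>D. interval_family (fst i) (snd i) (Q i) \<and>
      var (Q i) \<ge> \<bar>h (snd i) - h (fst i)\<bar> + 2 * r * (\<Sum>(l, m)\<in>S i. m - l)"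
      by (rule exE)
    have Q: "interval_family (fst i) (snd i) (Q i)"
      "var (Q i) \<ge> \<bar>h (snd i) - h (fst i)\<bar> + 2 * r * (\<Sum>(l, m)\<in>S i. m - l)" if "i \<in> D" for i
      using bspec[OF Qall that] by simp_all
    have "P \<subseteq> (\<Union>i\<in>D. S i)"
    proof
      fix j assume j: "j \<in> P"
      obtain l m where lm: "j = (l, m)" by (cases j)
      with j P(2) obtain x y where "(x, y) \<in> D" "x \<le> l" "m \<le> y" by (auto simp: K_def)
      moreover from this have "j \<in> S (x, y)" using j lm by (simp add: S_def)
      ultimately show "j \<in> (\<Union>i\<in>D. S i)" by blast
    qed
    moreover have "(\<Union>i\<in>D. S i) \<subseteq> P" by (auto simp: S_def)
    ultimately have "P = (\<Union>i\<in>D. S i)" by blast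
    then have lenP: "(\<Sum>(l, m)\<in>P. m - l) = (\<Sum>i\<in>D. \<Sum>(l, m)\<in>S i. m - l)"
      using interval_family_UN(2)[OF D Sfam, of "\<lambda>(l, m). m - l"] by simp
    \<comment> \<open>Refining every member yields a family whose variation exceeds
      \<open>var D\<close> by at least 2 * \<open>r\<close> times the length of \<open>P\<close>.
      Since \<open>var D\<close> is within \<epsilon> of the supremum \<open>V\<close>, that length
      is small.\<close>
    have "var D + 2 * r * (\<Sum>(l, m)\<in>P. m - l)
      = (\<Sum>i\<in>D. \<bar>h (snd i) - h (fst i)\<bar> + 2 * r * (\<Sum>(l, m)\<in>S i. m - l))"
      by (simp add: lenP[unfolded case_prod_unfold] var_def sum.distrib case_prod_unfold
          flip: sum_distrib_left)
    also have "\<dots> \<le> (\<Sum>i\<in>D. var (Q i))" using Q(2) by (rule sum_mono)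
    also have "\<dots> = var (\<Union>i\<in>D. Q i)"
      unfolding var_def using Q(1) by (subst interval_family_UN(2)[OF D, of Q]) auto
    also have "\<dots> \<le> V"
      using Q(1) by (intro V interval_family_UN(1)[OF D, of Q]) auto
    finally have "2 * r * (\<Sum>(l, m)\<in>P. m - l) \<le> \<epsilon>" using varD by linarith
    then show "(\<Sum>(l, m)\<in>P. m - l) \<le> \<epsilon> / (2 * r)"
      using \<open>r > 0\<close> by (simp add: field_simps)
  qed
  then obtain T where T: "E - F \<subseteq> T" "T \<in> lmeasurable" "measure lebesgue T \<le> e"
    using \<open>r > 0\<close> by (auto simp: \<epsilon>_def)
  have F0: "F \<in> lmeasurable" "measure lebesgue F = 0"
    using \<open>finite F\<close> negligible_finite negligible_imp_measurable negligible_imp_measure0 by blast+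
  have "measure lebesgue (T \<union> F) \<le> e"
    using measure_Un_le[of T lebesgue F] T F0 by auto
  then show "\<exists>T. E \<subseteq> T \<and> T \<in> lmeasurable \<and> measure lebesgue T \<le> e"
    using T F0 by (intro exI[of _ "T \<union> F"]) auto
qed

text \<open>A difference quotient at x is the slope over an interval with endpoint x, and it is
  symmetric in its two endpoints. So a condition met arbitrarily close to x yields intervals as the
  covering arguments take them.\<close>

lemma frequently_slope_interval:
  fixes f :: "real \<Rightarrow> real"
  assumes "\<not> eventually (\<lambda>y. \<not> P ((f y - f x) / (y - x))) (at x)" "\<delta> > 0"
  shows "\<exists>l m. l < m \<and> x \<in> {l..m} \<and> m - l < \<delta> \<and> P ((f m - f l) / (m - l))"
proof -
  obtain y where y: "y \<noteq> x" "dist y x < \<delta>" "P ((f y - f x) / (y - x))"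
    using assms unfolding eventually_at by (metis UNIV_I)
  show ?thesis
  proof (cases "x < y")
    case True
    then show ?thesis using y by (intro exI[of _ x] exI[of _ y]) (auto simp: dist_real_def)
  next
    case False
    moreover have "(f y - f x) / (y - x) = (f x - f y) / (x - y)"
      by (metis minus_diff_eq minus_divide_divide)
    ultimately show ?thesis
      using y by (intro exI[of _ y] exI[of _ x]) (auto simp: dist_real_def)
  qed
qed

text \<open>On disjoint intervals with slopes above n in absolute value the variation is at least n
  times the length, so their total length is at most \<open>B\<close> / n. The covering bound makes
  the outer measure at most 5 * \<open>B\<close> / n.\<close>

lemma negligible_unbounded_slopes:
  fixes f :: "real \<Rightarrow> real"
  assumes BV: "\<And>D. interval_family c d D \<Longrightarrow> (\<Sum>(x, y)\<in>D. \<bar>f y - f x\<bar>) \<le> B"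
    and E: "E \<subseteq> {c<..<d}"
    and steep: "\<And>x n \<delta>. x \<in> E \<Longrightarrow> \<delta> > 0 \<Longrightarrow>
      \<exists>l m. l < m \<and> x \<in> {l..m} \<and> m - l < \<delta> \<and> \<bar>(f m - f l) / (m - l)\<bar> > real n"
  shows "negligible E"
  unfolding negligible_outer_le
proof (intro allI impI)
  fix e :: real assume "e > 0"
  obtain n :: nat where n: "n > 0" "5 * (B / n) \<le> e"
  proof -
    obtain n :: nat where "real n > max 1 (5 * B / e)" using reals_Archimedean2 by blast
    then show ?thesis using \<open>e > 0\<close> by (intro that[of n]) (auto simp: field_simps)
  qed
  define K where "K = {(l, m). c \<le> l \<and> l < m \<and> m \<le> d \<and> \<bar>(f m - f l) / (m - l)\<bar> > real n}"
  have "\<exists>T. E \<subseteq> T \<and> T \<in> lmeasurable \<and> measure lebesgue T \<le> 5 * (B / n)"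
  proof (rule Vitali_intervals_bound[where B="d - c"])
    show "E \<subseteq> (\<Union>(l, m)\<in>K. {l..m})"
    proof
      fix x assume x: "x \<in> E"
      then have "min (x - c) (d - x) > 0" using E by auto
      from steep[OF x this, of n] obtain l m where
        lm: "l < m" "x \<in> {l..m}" "m - l < min (x - c) (d - x)" "\<bar>(f m - f l) / (m - l)\<bar> > real n"
        by blast
      then have "(l, m) \<in> K" by (auto simp: K_def)
      with lm(2) show "x \<in> (\<Union>(l, m)\<in>K. {l..m})" by blast
    qed
    show "l < m \<and> m - l \<le> d - c" if "(l, m) \<in> K" for l m
      using that by (auto simp: K_def)
    fix P assume P: "finite P" "P \<subseteq> K"
      "pairwise (\<lambda>i j. disjnt {fst i..snd i} {fst j..snd j}) P"
    have fam: "interval_family c d P"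
      using P by (intro interval_family_if_disjnt) (auto simp: K_def)
    have "n * (\<Sum>(l, m)\<in>P. m - l) \<le> (\<Sum>(l, m)\<in>P. \<bar>f m - f l\<bar>)"
      unfolding sum_distrib_left
    proof (rule sum_mono, clarify)
      fix l m assume "(l, m) \<in> P"
      then have "l < m" "\<bar>(f m - f l) / (m - l)\<bar> > real n" using P(2) by (auto simp: K_def)
      then show "n * (m - l) \<le> \<bar>f m - f l\<bar>" by (simp add: abs_divide field_simps)
    qed
    also have "\<dots> \<le> B" by (rule BV[OF fam])
    finally show "(\<Sum>(l, m)\<in>P. m - l) \<le> B / n" using n(1) by (simp add: field_simps)
  qed
  then show "\<exists>T. E \<subseteq> T \<and> T \<in> lmeasurable \<and> measure lebesgue T \<le> e"
    using n(2) order_trans by blast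
qed

section \<open>Lebesgue's differentiation theorem\<close>

text \<open>If the slopes at x are bounded but have no limit, two rationals p < q separate the lower
  from the upper derivative. Subtracting the linear function of slope (p + q) / 2 turns slopes below
  p and above q into slopes of opposite sign, the situation of Austin's argument. Only countably
  many pairs (p, q) occur.\<close>

theorem bounded_variation_differentiable_ae:
  fixes f :: "real \<Rightarrow> real"
  assumes BV: "\<And>D. interval_family c d D \<Longrightarrow> (\<Sum>(x, y)\<in>D. \<bar>f y - f x\<bar>) \<le> B"
  shows "negligible {x \<in> {c<..<d}. \<not> f differentiable (at x)}"
proof (cases "c < d")
  case False
  then show ?thesis by simp
next
  case True
  define steep where "steep P x \<longleftrightarrow>
    (\<forall>\<delta>>0. \<exists>l m. l < m \<and> x \<in> {l..m} \<and> m - l < \<delta> \<and> P ((f m - f l) / (m - l)))" for P x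
  define N where "N = {x \<in> {c<..<d}. \<forall>n. steep (\<lambda>s. \<bar>s\<bar> > real n) x}"
  define M where "M = (\<lambda>(p, q). {x \<in> {c<..<d}. steep (\<lambda>s. s < p) x \<and> steep (\<lambda>s. s > q) x})"
  have "negligible N"
    by (rule negligible_unbounded_slopes[OF BV]) (auto simp: N_def steep_def)
  have M: "negligible (M (p, q))" if "p < q" for p q
  proof -
    define h where "h x = f x - (p + q) / 2 * x" for x
    have hl: "h m - h l = f m - f l - (p + q) / 2 * (m - l)" for l m
      by (simp add: h_def right_diff_distrib)
    have slope: "h m - h l = ((f m - f l) / (m - l) - (p + q) / 2) * (m - l)" if "l < m" for l m
      unfolding hl left_diff_distrib[of "(f m - f l) / (m - l)"] using that by simp
    show ?thesis
    proof (rule negligible_opposite_slopes)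
      show "c \<le> d" "(q - p) / 2 > 0" using True that by auto
      show "M (p, q) \<subseteq> {c<..<d}" by (auto simp: M_def)
      fix D assume D: "interval_family c d D"
      \<comment> \<open>Tilting raises the variation of a family by at most |(p + q) / 2| times its
        total length, so it stays bounded.\<close>
      have "(\<Sum>(x, y)\<in>D. \<bar>h y - h x\<bar>) \<le> (\<Sum>(x, y)\<in>D. \<bar>f y - f x\<bar> + \<bar>(p + q) / 2\<bar> * (y - x))"
      proof (rule sum_mono, clarify)
        fix x y assume "(x, y) \<in> D"
        then have "x < y" using interval_familyD(2)[OF D] by blast
        then have "\<bar>(p + q) / 2 * (y - x)\<bar> = \<bar>(p + q) / 2\<bar> * (y - x)" by (simp add: abs_mult)
        then show "\<bar>h y - h x\<bar> \<le> \<bar>f y - f x\<bar> + \<bar>(p + q) / 2\<bar> * (y - x)"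
          unfolding hl by linarith
      qed
      also have "\<dots> = (\<Sum>(x, y)\<in>D. \<bar>f y - f x\<bar>) + \<bar>(p + q) / 2\<bar> * (\<Sum>(x, y)\<in>D. y - x)"
        by (simp add: sum.distrib sum_distrib_left case_prod_unfold)
      also have "\<dots> \<le> B + \<bar>(p + q) / 2\<bar> * (d - c)"
        using BV[OF D] interval_family_length_le[OF D] True
        by (intro add_mono mult_left_mono) auto
      finally show "(\<Sum>(x, y)\<in>D. \<bar>h y - h x\<bar>) \<le> B + \<bar>(p + q) / 2\<bar> * (d - c)" .
    next
      fix x \<delta> :: real assume x: "x \<in> M (p, q)" and "\<delta> > 0"
      then obtain l m where lm: "l < m" "x \<in> {l..m}" "m - l < \<delta>" "(f m - f l) / (m - l) > q"
        by (auto simp: M_def steep_def)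
      then have "((f m - f l) / (m - l) - (p + q) / 2) * (m - l) > (q - p) / 2 * (m - l)"
        by (intro mult_strict_right_mono) (auto simp: field_split_simps)
      then show "\<exists>l m. l < m \<and> x \<in> {l..m} \<and> m - l < \<delta> \<and> h m - h l > (q - p) / 2 * (m - l)"
        using slope[OF lm(1)] lm by (intro exI[of _ l] exI[of _ m]) auto
    next
      fix x \<delta> :: real assume x: "x \<in> M (p, q)" and "\<delta> > 0"
      then obtain l m where lm: "l < m" "x \<in> {l..m}" "m - l < \<delta>" "(f m - f l) / (m - l) < p"
        by (auto simp: M_def steep_def)
      then have "((f m - f l) / (m - l) - (p + q) / 2) * (m - l) < - ((q - p) / 2) * (m - l)"
        by (intro mult_strict_right_mono) (auto simp: field_split_simps)
      then show "\<exists>l m. l < m \<and> x \<in> {l..m} \<and> m - l < \<delta> \<and> h m - h l < - ((q - p) / 2) * (m - l)"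
        using slope[OF lm(1)] lm by (intro exI[of _ l] exI[of _ m]) auto
    qed
  qed
  have "x \<in> N \<union> (\<Union>i\<in>{(p, q)\<in>\<rat> \<times> \<rat>. p < q}. M i)"
    if x: "x \<in> {c<..<d}" and nd: "\<not> f differentiable (at x)" for x
  proof (rule ccontr)
    assume contra: "\<not> ?thesis"
    define s where "s y = (f y - f x) / (y - x)" for y
    have ev: "eventually (\<lambda>y. \<not> P (s y)) (at x)" if "\<not> steep P x" for P
      using frequently_slope_interval[of P f x] that unfolding steep_def s_def by blast
    \<comment> \<open>The limit is taken in the extended reals, where upper and lower limits always
      exist; the bound on the slopes makes it finite afterwards.\<close>
    have "Limsup (at x) s' \<le> Liminf (at x) s'" if s': "s' = (\<lambda>y. ereal (s y))" for s'
    proof (rule ccontr)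
      assume "\<not> ?thesis"
      then have "Liminf (at x) s' < Limsup (at x) s'" by simp
      then obtain p where p: "p \<in> \<rat>" "Liminf (at x) s' < ereal p" "ereal p < Limsup (at x) s'"
        using ereal_dense3 unfolding Rats_def by (metis rangeI)
      then obtain q where q: "q \<in> \<rat>" "ereal p < ereal q" "ereal q < Limsup (at x) s'"
        using ereal_dense3[OF p(3)] unfolding Rats_def by (metis rangeI)
      have "steep (\<lambda>t. t < p) x"
      proof (rule ccontr)
        assume "\<not> ?thesis"
        from ev[OF this] have "ereal p \<le> Liminf (at x) s'"
          by (intro Liminf_bounded) (simp add: s' not_less)
        with p(2) show False by simp
      qed
      moreover have "steep (\<lambda>t. t > q) x"
      proof (rule ccontr)
        assume "\<not> ?thesis"
        from ev[OF this] have "Limsup (at x) s' \<le> ereal q"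
          by (intro Limsup_bounded) (simp add: s' not_less)
        with q(3) show False by simp
      qed
      ultimately have "x \<in> M (p, q)" using x by (simp add: M_def)
      with contra p(1) q(1,2) show False by auto
    qed
    then have "Limsup (at x) (\<lambda>y. ereal (s y)) = Liminf (at x) (\<lambda>y. ereal (s y))"
      by (intro antisym Liminf_le_Limsup) auto
    then have lim: "((\<lambda>y. ereal (s y)) \<longlongrightarrow> Liminf (at x) (\<lambda>y. ereal (s y))) (at x)"
      by (intro tendsto_Liminf) auto
    obtain n where "\<not> steep (\<lambda>t. \<bar>t\<bar> > real n) x" using contra x by (auto simp: N_def)
    from ev[OF this] have n: "eventually (\<lambda>y. \<bar>s y\<bar> \<le> n) (at x)" by (simp add: not_less)
    have "Liminf (at x) (\<lambda>y. ereal (s y)) \<le> ereal n"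
      by (rule tendsto_upperbound[OF lim]) (use n in \<open>auto elim: eventually_mono\<close>)
    moreover have "Liminf (at x) (\<lambda>y. ereal (s y)) \<ge> ereal (- n)"
      by (rule tendsto_lowerbound[OF lim]) (use n in \<open>auto elim!: eventually_mono\<close>)
    ultimately obtain L where "Liminf (at x) (\<lambda>y. ereal (s y)) = ereal L"
      by (cases "Liminf (at x) (\<lambda>y. ereal (s y))") auto
    with lim have "(s \<longlongrightarrow> L) (at x)" by simp
    then have "(f has_field_derivative L) (at x)"
      unfolding has_field_derivative_iff s_def .
    with nd show False using real_differentiable_def by blast
  qed
  then have "{x \<in> {c<..<d}. \<not> f differentiable (at x)} \<subseteq> N \<union> (\<Union>i\<in>{(p, q)\<in>\<rat> \<times> \<rat>. p < q}. M i)"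
    by blast
  moreover have "negligible (N \<union> (\<Union>i\<in>{(p, q)\<in>\<rat> \<times> \<rat>. p < q}. M i))"
  proof (intro negligible_Un negligible_countable_Union countable_image)
    show "countable {(p :: real, q). (p, q) \<in> \<rat> \<times> \<rat> \<and> p < q}"
      by (rule countable_subset[of _ "\<rat> \<times> \<rat>"]) (auto intro: countable_rat)
  qed (use \<open>negligible N\<close> M in auto)
  ultimately show ?thesis using negligible_subset by blast
qed

section \<open>The fundamental theorem of calculus for absolutely continuous functions\<close>

lemma absolutely_continuous_fun_onD:
  assumes "absolutely_continuous_fun_on a b f" "\<epsilon> > 0"
  obtains \<delta> where "\<delta> > 0" "\<And>D. interval_family a b D \<Longrightarrow> (\<Sum>(x, y)\<in>D. y - x) < \<delta> \<Longrightarrow>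
    (\<Sum>(x, y)\<in>D. norm (f y - f x)) < \<epsilon>"
proof -
  obtain \<delta> where \<delta>: "\<delta> > 0"
    "\<forall>D. finite D \<longrightarrow> (\<forall>(x, y)\<in>D. a \<le> x \<and> x < y \<and> y \<le> b) \<longrightarrow>
      disjoint_family_on (\<lambda>(x, y). {x<..<y}) D \<longrightarrow> (\<Sum>(x, y)\<in>D. y - x) < \<delta> \<longrightarrow>
      (\<Sum>(x, y)\<in>D. norm (f y - f x)) < \<epsilon>"
    using assms unfolding absolutely_continuous_fun_on_def by blast
  show thesis
    by (rule that[OF \<delta>(1)]) (use \<delta>(2) in \<open>simp add: interval_family_def\<close>)
qed

lemma absolutely_continuous_fun_on_subinterval:
  assumes "absolutely_continuous_fun_on a b f" "a \<le> c" "d \<le> b"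
  shows "absolutely_continuous_fun_on c d f"
  unfolding absolutely_continuous_fun_on_def
proof (intro allI impI)
  fix \<epsilon> :: real assume "\<epsilon> > 0"
  from absolutely_continuous_fun_onD[OF assms(1) this] obtain \<delta> where "\<delta> > 0"
    "\<And>D. interval_family a b D \<Longrightarrow> (\<Sum>(x, y)\<in>D. y - x) < \<delta> \<Longrightarrow>
    (\<Sum>(x, y)\<in>D. norm (f y - f x)) < \<epsilon>" by blast
  with interval_family_mono[OF _ assms(2,3)]
  show "\<exists>\<delta>>0. \<forall>D. finite D \<longrightarrow> (\<forall>(x, y)\<in>D. c \<le> x \<and> x < y \<and> y \<le> d) \<longrightarrow>
    disjoint_family_on (\<lambda>(c, d). {c<..<d}) D \<longrightarrow> (\<Sum>(c, d)\<in>D. d - c) < \<delta> \<longrightarrow>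
    (\<Sum>(c, d)\<in>D. norm (f d - f c)) < \<epsilon>"
    by (intro exI[of _ \<delta>]) (simp add: interval_family_def)
qed

lemma absolutely_continuous_fun_on_imp_continuous_on:
  assumes "absolutely_continuous_fun_on a b f"
  shows "continuous_on {a..b} f"
  unfolding continuous_on_iff
proof (intro ballI allI impI)
  fix x e :: real assume x: "x \<in> {a..b}" and "e > 0"
  from absolutely_continuous_fun_onD[OF assms this(2)] obtain \<delta> where \<delta>: "\<delta> > 0"
    "\<And>D. interval_family a b D \<Longrightarrow> (\<Sum>(x, y)\<in>D. y - x) < \<delta> \<Longrightarrow>
    (\<Sum>(x, y)\<in>D. norm (f y - f x)) < e" by blast
  have "dist (f y) (f x) < e" if y: "y \<in> {a..b}" "dist y x < \<delta>" for y
  proof (cases "y = x")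
    case False
    have "interval_family a b {(min x y, max x y)}"
      using x y False by (intro interval_familyI) auto
    moreover have "(\<Sum>(x, y)\<in>{(min x y, max x y)}. y - x) < \<delta>"
      using y by (auto simp: dist_real_def)
    ultimately have "(\<Sum>(x, y)\<in>{(min x y, max x y)}. norm (f y - f x)) < e"
      by (rule \<delta>(2))
    then show ?thesis
      by (cases "x < y") (auto simp: dist_norm norm_minus_commute max_def min_def split: if_splits)
  qed (use \<open>e > 0\<close> in auto)
  with \<delta>(1) show "\<exists>d>0. \<forall>y\<in>{a..b}. dist y x < d \<longrightarrow> dist (f y) (f x) < e" by blast
qed

lemma negligible_open_cover:
  fixes N :: "real set"
  assumes "negligible N" "e > 0"
  obtains G where "open G" "N \<subseteq> G" "G \<in> lmeasurable" "measure lebesgue G < e"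
proof -
  have N: "N \<in> sets lebesgue" "emeasure lebesgue N = 0"
    using assms(1) by (auto simp: negligible_iff_null_sets)
  obtain G where G: "open G" "N \<subseteq> G" "G - N \<in> lmeasurable" "emeasure lebesgue (G - N) < ennreal e"
    using sets_lebesgue_outer_open[OF N(1) assms(2)] by blast
  have *: "G = (G - N) \<union> N" using G(2) by blast
  have "N \<in> lmeasurable" using assms(1) negligible_imp_measurable by blast
  then have "G \<in> lmeasurable" using G(3) * by (metis fmeasurable.Un)
  moreover have "measure lebesgue G < e"
  proof -
    have "measure lebesgue G \<le> measure lebesgue (G - N) + measure lebesgue N"
      using * measure_Un_le[of "G - N" lebesgue N] G(3) N(1) by auto
    also have "measure lebesgue N = 0" using assms(1) negligible_imp_measure0 by blast
    also have "measure lebesgue (G - N) < e"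
      using G(3,4) \<open>e > 0\<close> by (simp add: emeasure_eq_measure2 ennreal_less_iff)
    finally show ?thesis by simp
  qed
  ultimately show thesis using G(1,2) that by blast
qed

text \<open>
  Subintervals tagged in the exceptional set lie in an open set of small measure, so absolute
  continuity makes their contribution small.
\<close>

theorem fundamental_theorem_of_calculus_absolutely_continuous:
  fixes f :: "real \<Rightarrow> 'b::banach"
  assumes AC: "absolutely_continuous_fun_on a b f" and "a \<le> b" and N: "negligible N"
    and g: "\<And>x. x \<in> {a..b} - N \<Longrightarrow> (f has_vector_derivative g x) (at x within {a..b})"
  shows "(g has_integral (f b - f a)) {a..b}"
proof (cases "a = b")
  case True
  then show ?thesis by (simp add: has_integral_refl(2))
next
  case False
  then have "a < b" using \<open>a \<le> b\<close> by simp
  \<comment> \<open>With value 0 on \<open>N\<close>, a tag in \<open>N\<close> contributes only the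
    increment of \<open>f\<close> to the error; a change on a negligible set does not affect the
    integral.\<close>
  define g' where "g' x = (if x \<in> N then 0 else g x)" for x
  have "(g' has_integral (f b - f a)) {a..b}"
    unfolding has_integral_factor_content_real
  proof (intro allI impI)
    fix e :: real assume "e > 0"
    \<comment> \<open>One half of the error is for tags in \<open>N\<close>, the other half for the
      remaining tags.\<close>
    define e' where "e' = e / 2"
    have "e' > 0" using \<open>e > 0\<close> by (simp add: e'_def)
    then have "e' * (b - a) > 0" using \<open>a < b\<close> by simp
    from absolutely_continuous_fun_onD[OF AC this] obtain \<delta> where \<delta>: "\<delta> > 0"
      "\<And>D. interval_family a b D \<Longrightarrow> (\<Sum>(x, y)\<in>D. y - x) < \<delta> \<Longrightarrow>
        (\<Sum>(x, y)\<in>D. norm (f y - f x)) < e' * (b - a)" by blast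
    obtain G where G: "open G" "N \<subseteq> G" "G \<in> lmeasurable" "measure lebesgue G < \<delta>"
      using negligible_open_cover[OF N \<delta>(1)] by blast
    \<comment> \<open>The gauge does two jobs: around a point of \<open>N\<close> its ball stays
      inside the small open set \<open>G\<close>, and at the other points of {a..b} it makes the
      linear approximation of \<open>f\<close> accurate.\<close>
    have "\<exists>r>0. (x \<in> N \<longrightarrow> ball x r \<subseteq> G) \<and> (x \<in> {a..b} - N \<longrightarrow>
      (\<forall>y\<in>{a..b}. norm (y - x) < r \<longrightarrow> norm (f y - f x - (y - x) *\<^sub>R g x) \<le> e' * norm (y - x)))" for x
    proof (cases "x \<in> N")
      case True
      then show ?thesis using G(1,2) openE by (metis DiffE subsetD)
    next
      case False
      show ?thesis
      proof (cases "x \<in> {a..b}")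
        case True
        then show ?thesis
          using g[of x] False \<open>e' > 0\<close>
          unfolding has_vector_derivative_def has_derivative_within_alt by blast
      qed (use False in \<open>auto intro: exI[of _ 1]\<close>)
    qed
    then obtain r where r: "\<And>x. r x > 0" "\<And>x. x \<in> N \<Longrightarrow> ball x (r x) \<subseteq> G"
      "\<And>x y. x \<in> {a..b} - N \<Longrightarrow> y \<in> {a..b} \<Longrightarrow> norm (y - x) < r x \<Longrightarrow>
        norm (f y - f x - (y - x) *\<^sub>R g x) \<le> e' * norm (y - x)"
      by metis
    have main: "norm ((\<Sum>(x, K)\<in>p. measure lborel K *\<^sub>R g' x) - (f b - f a)) \<le> e * measure lborel {a..b}"
      if p: "p tagged_division_of {a..b}" and fine: "(\<lambda>x. ball x (r x)) fine p" for p
    proof -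
      note pD = tagged_division_ofD[OF p]
      have K: "K = {Inf K..Sup K} \<and> a \<le> Inf K \<and> Inf K \<le> x \<and> x \<le> Sup K \<and> Sup K \<le> b \<and> K \<subseteq> ball x (r x)"
        if Kp: "(x, K) \<in> p" for x K
      proof -
        obtain l m where lm: "K = {l..m}" using pD(4)[OF Kp] by auto
        have "x \<in> {l..m}" "{l..m} \<subseteq> {a..b}" using pD(2,3)[OF Kp] lm by auto
        moreover have "K \<subseteq> ball x (r x)" using fine Kp by (auto simp: fine_def)
        ultimately show ?thesis using lm by auto
      qed
      define p1 where "p1 = {(x, K)\<in>p. x \<in> N}"
      have p1p: "p1 \<subseteq> p" by (auto simp: p1_def)
      have "finite p1" using finite_subset[OF p1p pD(1)] .
      have nonN: "norm (measure lborel K *\<^sub>R g' x - (f (Sup K) - f (Inf K))) \<le> e' * measure lborel K"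
        if "(x, K) \<in> p - p1" for x K
      proof -
        have xK: "(x, K) \<in> p" "x \<notin> N" using that by (auto simp: p1_def)
        obtain l m where lm: "l = Inf K" "m = Sup K" by blast
        note K' = K[OF xK(1), folded lm]
        have lmx: "l \<in> K" "m \<in> K" using K' by auto
        then have "l \<in> ball x (r x)" "m \<in> ball x (r x)" using K' by blast+
        then have "norm (l - x) < r x" "norm (m - x) < r x"
          by (auto simp: dist_norm norm_minus_commute)
        moreover have "x \<in> {a..b} - N" "l \<in> {a..b}" "m \<in> {a..b}" using K' xK(2) by auto
        ultimately have est: "norm (f l - f x - (l - x) *\<^sub>R g x) \<le> e' * norm (l - x)"
          "norm (f m - f x - (m - x) *\<^sub>R g x) \<le> e' * norm (m - x)"
          using r(3) by blast+
        have cK: "measure lborel K = m - l" using K' by (metis content_real order_trans)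
        \<comment> \<open>Straddling: the tag lies between l and m, so |l - x| + |m - x| = m - l and
          the two one-sided errors add up to a multiple of the length of \<open>K\<close>.\<close>
        have "measure lborel K *\<^sub>R g' x - (f m - f l)
          = (f l - f x - (l - x) *\<^sub>R g x) - (f m - f x - (m - x) *\<^sub>R g x)"
          using xK(2) by (simp add: cK g'_def algebra_simps)
        then have "norm (measure lborel K *\<^sub>R g' x - (f m - f l))
          \<le> norm (f l - f x - (l - x) *\<^sub>R g x) + norm (f m - f x - (m - x) *\<^sub>R g x)"
          by (simp only: norm_triangle_ineq4)
        also have "\<dots> \<le> e' * norm (l - x) + e' * norm (m - x)"
          using est by (rule add_mono)
        also have "\<dots> = e' * measure lborel K" using K' by (simp add: cK algebra_simps)
        finally show ?thesis unfolding lm .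
      qed
      have small: "(\<Sum>(x, K)\<in>p1. norm (f (Sup K) - f (Inf K))) < e' * (b - a)"
      proof -
        obtain D where D: "interval_family a b D" "D \<subseteq> (\<lambda>i. (Inf (snd i), Sup (snd i))) ` p1"
          "\<And>g :: real \<Rightarrow> real \<Rightarrow> real. (\<And>x. g x x = 0) \<Longrightarrow>
            (\<Sum>i\<in>p1. g (Inf (snd i)) (Sup (snd i))) = (\<Sum>(x, y)\<in>D. g x y)"
        proof (rule interval_family_of_indexed[OF \<open>finite p1\<close>])
          show "a \<le> Inf (snd i) \<and> Inf (snd i) \<le> Sup (snd i) \<and> Sup (snd i) \<le> b" if "i \<in> p1" for i
            using K[of "fst i" "snd i"] that p1p by (metis order_trans prod.collapse subsetD)
          show "{Inf (snd i)<..<Sup (snd i)} \<inter> {Inf (snd j)<..<Sup (snd j)} = {}"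
            if "i \<in> p1" "j \<in> p1" "i \<noteq> j" for i j
          proof -
            have "interior (snd i) \<inter> interior (snd j) = {}"
              using pD(5)[of "fst i" "snd i" "fst j" "snd j"] that p1p by auto
            moreover have "snd i = {Inf (snd i)..Sup (snd i)}" "snd j = {Inf (snd j)..Sup (snd j)}"
              using K[of "fst i" "snd i"] K[of "fst j" "snd j"] that p1p by auto
            ultimately show ?thesis by (metis interior_atLeastAtMost_real)
          qed
        qed blast
        note famD = interval_familyD[OF D(1)]
        have "(\<Sum>(x, y)\<in>D. y - x) = (\<Sum>i\<in>D. measure lebesgue (case i of (x, y) \<Rightarrow> {x<..<y}))"
          by (rule sum.cong) (use famD(2) in \<open>auto simp: less_imp_le\<close>)
        also have "\<dots> = measure lebesgue (\<Union>i\<in>D. case i of (x, y) \<Rightarrow> {x<..<y})"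
          using D(1) by (intro measure_finite_Union[symmetric]) (auto simp: interval_family_def)
        also have "\<dots> \<le> measure lebesgue G"
        proof (rule measure_mono_fmeasurable)
          show "(\<Union>i\<in>D. case i of (x, y) \<Rightarrow> {x<..<y}) \<subseteq> G"
          proof clarify
            fix x y z assume "(x, y) \<in> D" "z \<in> {x<..<y}"
            then obtain t K where "(t, K) \<in> p1" "x = Inf K" "y = Sup K" using D(2) by auto
            then have tK: "(t, K) \<in> p" "t \<in> N" "z \<in> {Inf K..Sup K}"
              using \<open>z \<in> {x<..<y}\<close> by (auto simp: p1_def)
            then have "z \<in> ball t (r t)" using K[OF tK(1)] by blast
            then show "z \<in> G" using r(2)[OF tK(2)] by blast
          qed
          show "(\<Union>i\<in>D. case i of (x, y) \<Rightarrow> {x<..<y}) \<in> sets lebesgue"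
            using famD(1) by (intro sets.finite_UN) auto
        qed (rule G(3))
        finally have "(\<Sum>(x, y)\<in>D. y - x) < \<delta>" using G(4) by linarith
        from \<delta>(2)[OF D(1) this] D(3)[of "\<lambda>x y. norm (f y - f x)"]
        show ?thesis by (simp add: case_prod_unfold)
      qed
      have inN: "(\<Sum>(x, K)\<in>p1. norm (measure lborel K *\<^sub>R g' x - (f (Sup K) - f (Inf K)))) \<le> e' * (b - a)"
      proof -
        have "(\<Sum>(x, K)\<in>p1. norm (measure lborel K *\<^sub>R g' x - (f (Sup K) - f (Inf K))))
          = (\<Sum>(x, K)\<in>p1. norm (f (Sup K) - f (Inf K)))"
          by (rule sum.cong) (auto simp: p1_def g'_def norm_minus_commute)
        with small show ?thesis by linarith
      qed
      have "(\<Sum>(x, K)\<in>p - p1. norm (measure lborel K *\<^sub>R g' x - (f (Sup K) - f (Inf K))))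
        \<le> (\<Sum>(x, K)\<in>p - p1. e' * measure lborel K)"
        by (rule sum_mono) (use nonN in auto)
      also have "\<dots> \<le> (\<Sum>(x, K)\<in>p. e' * measure lborel K)"
        using pD(1) \<open>e' > 0\<close> by (intro sum_mono2) auto
      also have "\<dots> = e' * (b - a)"
        using additive_content_tagged_division[of p a b] p \<open>a \<le> b\<close>
        by (simp add: case_prod_unfold flip: sum_distrib_left)
      finally have outN: "(\<Sum>(x, K)\<in>p - p1. norm (measure lborel K *\<^sub>R g' x - (f (Sup K) - f (Inf K))))
        \<le> e' * (b - a)" .
      have "(\<Sum>(x, K)\<in>p. measure lborel K *\<^sub>R g' x) - (f b - f a)
        = (\<Sum>(x, K)\<in>p. measure lborel K *\<^sub>R g' x - (f (Sup K) - f (Inf K)))"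
        using additive_tagged_division_1[OF \<open>a \<le> b\<close> p, of f]
        by (simp add: sum_subtractf case_prod_unfold)
      also have "norm \<dots> \<le> (\<Sum>(x, K)\<in>p. norm (measure lborel K *\<^sub>R g' x - (f (Sup K) - f (Inf K))))"
        by (rule order_trans[OF norm_sum]) (simp add: case_prod_unfold)
      also have "\<dots> = (\<Sum>(x, K)\<in>p1. norm (measure lborel K *\<^sub>R g' x - (f (Sup K) - f (Inf K))))
        + (\<Sum>(x, K)\<in>p - p1. norm (measure lborel K *\<^sub>R g' x - (f (Sup K) - f (Inf K))))"
        using sum.subset_diff[OF p1p pD(1)] by (simp add: add.commute)
      also have "\<dots> \<le> e * (b - a)" using inN outN by (simp add: e'_def field_simps)
      finally show ?thesis using \<open>a \<le> b\<close> by simp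
    qed
    show "\<exists>d. gauge d \<and> (\<forall>p. p tagged_division_of {a..b} \<and> d fine p \<longrightarrow>
      norm ((\<Sum>(x, K)\<in>p. measure lborel K *\<^sub>R g' x) - (f b - f a)) \<le> e * measure lborel {a..b})"
      using main r(1) by (intro exI[of _ "\<lambda>x. ball x (r x)"]) (auto intro: gauge_ball_dependent)
  qed
  then show ?thesis
    by (rule has_integral_spike[OF N, rotated]) (auto simp: g'_def)
qed

text \<open>Absolute continuity with \<epsilon> = 1 bounds the variation by 1 on intervals shorter
  than \<delta>. There the coordinates of \<open>f\<close> have bounded variation, which gives
  differentiability, and so does the indefinite integral of the derivative, which gives absolute
  integrability. Bisection extends both to {a..b}.\<close>

theorem absolutely_continuous_vector_derivative:
  fixes f :: "real \<Rightarrow> 'b::euclidean_space"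
  assumes AC: "absolutely_continuous_fun_on a b f" and "a \<le> b"
  shows "negligible {x \<in> {a..b}. \<not> f differentiable (at x)}"
    and "(\<lambda>x. vector_derivative f (at x)) absolutely_integrable_on {a..b}"
    and "((\<lambda>x. vector_derivative f (at x)) has_integral (f b - f a)) {a..b}"
proof -
  define g where "g x = vector_derivative f (at x)" for x
  obtain \<delta> where \<delta>: "\<delta> > 0"
    "\<And>D. interval_family a b D \<Longrightarrow> (\<Sum>(x, y)\<in>D. y - x) < \<delta> \<Longrightarrow> (\<Sum>(x, y)\<in>D. norm (f y - f x)) < 1"
    using absolutely_continuous_fun_onD[OF AC, of 1] by auto
  have BV: "(\<Sum>(x, y)\<in>D. norm (f y - f x)) \<le> 1"
    if "interval_family c d D" "a \<le> c" "c \<le> d" "d \<le> b" "d - c < \<delta>" for c d D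
    using \<delta>(2)[OF interval_family_mono[OF that(1,2,4)]] interval_family_length_le[OF that(1,3)] that(5)
    by linarith
  define N where "N c d = {x \<in> {c..d}. \<not> f differentiable (at x)}" for c d
  have local_N: "negligible (N c d)" if cd: "a \<le> c" "c \<le> d" "d \<le> b" "d - c < \<delta>" for c d
  proof -
    have "negligible {x \<in> {c<..<d}. \<not> (\<lambda>x. f x \<bullet> i) differentiable (at x)}" if "i \<in> Basis" for i
    proof (rule bounded_variation_differentiable_ae)
      fix D assume D: "interval_family c d D"
      have "(\<Sum>(x, y)\<in>D. \<bar>f y \<bullet> i - f x \<bullet> i\<bar>) \<le> (\<Sum>(x, y)\<in>D. norm (f y - f x))"
        using Basis_le_norm[OF that] by (intro sum_mono) (auto simp flip: inner_diff_left)
      also have "\<dots> \<le> 1" by (rule BV[OF D cd])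
      finally show "(\<Sum>(x, y)\<in>D. \<bar>f y \<bullet> i - f x \<bullet> i\<bar>) \<le> 1" .
    qed
    \<comment> \<open>\<open>at x\<close> is two-sided and the previous fact concerns the open
      interval, so the endpoints are put into the exceptional set.\<close>
    then have "negligible ({c, d} \<union> (\<Union>i\<in>Basis. {x \<in> {c<..<d}. \<not> (\<lambda>x. f x \<bullet> i) differentiable (at x)}))"
      by (intro negligible_Un negligible_Union) auto
    moreover have "N c d \<subseteq> {c, d} \<union> (\<Union>i\<in>Basis. {x \<in> {c<..<d}. \<not> (\<lambda>x. f x \<bullet> i) differentiable (at x)})"
      using differentiable_componentwise_within[of f _ UNIV] by (auto simp: N_def)
    ultimately show ?thesis using negligible_subset by blast
  qed
  have int: "(g has_integral (f y - f x)) {x..y}" if "a \<le> x" "x \<le> y" "y \<le> b" "negligible (N x y)" for x y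
  proof (rule fundamental_theorem_of_calculus_absolutely_continuous[OF _ _ that(4)])
    show "absolutely_continuous_fun_on x y f"
      using absolutely_continuous_fun_on_subinterval[OF AC] that by blast
    show "(f has_vector_derivative g t) (at t within {x..y})" if "t \<in> {x..y} - N x y" for t
      using that vector_derivative_works[of f "at t"] has_vector_derivative_at_within
      by (auto simp: N_def g_def)
  qed (use that in auto)
  have local_int: "g absolutely_integrable_on {c..d}"
    if cd: "a \<le> c" "c \<le> d" "d \<le> b" "d - c < \<delta>" for c d
  proof -
    have sub: "(g has_integral (f y - f x)) {x..y}" if "c \<le> x" "x \<le> y" "y \<le> d" for x y
    proof (rule int)
      show "negligible (N x y)"
        using local_N[OF cd] by (rule negligible_subset) (use that in \<open>auto simp: N_def\<close>)
    qed (use that cd in auto)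
    have "g absolutely_integrable_on cbox c d"
    proof (rule bounded_variation_absolutely_integrable_interval)
      show "g integrable_on cbox c d" using sub[of c d] cd by auto
      fix p assume p: "p division_of cbox c d"
      note pD = division_ofD[OF p]
      have K: "K = {Inf K..Sup K} \<and> c \<le> Inf K \<and> Inf K \<le> Sup K \<and> Sup K \<le> d" if Kp: "K \<in> p" for K
      proof -
        obtain l m where lm: "K = {l..m}" using pD(4)[OF Kp] by auto
        have "{l..m} \<noteq> {}" "{l..m} \<subseteq> {c..d}" using pD(2,3)[OF Kp] lm by auto
        then show ?thesis using lm by auto
      qed
      obtain D where D: "interval_family c d D"
        "\<And>g :: real \<Rightarrow> real \<Rightarrow> real. (\<And>x. g x x = 0) \<Longrightarrow>
          (\<Sum>K\<in>p. g (Inf K) (Sup K)) = (\<Sum>(x, y)\<in>D. g x y)"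
      proof (rule interval_family_of_indexed[OF pD(1)])
        show "c \<le> Inf K \<and> Inf K \<le> Sup K \<and> Sup K \<le> d" if "K \<in> p" for K
          using K[OF that] by blast
        show "{Inf i<..<Sup i} \<inter> {Inf j<..<Sup j} = {}" if "i \<in> p" "j \<in> p" "i \<noteq> j" for i j
          using pD(5)[OF that] K[OF that(1)] K[OF that(2)] by (metis interior_atLeastAtMost_real)
      qed blast
      have "(\<Sum>K\<in>p. norm (integral K g)) = (\<Sum>K\<in>p. norm (f (Sup K) - f (Inf K)))"
        using K sub by (intro sum.cong refl arg_cong[where f=norm]) (metis integral_unique)
      also have "\<dots> = (\<Sum>(x, y)\<in>D. norm (f y - f x))" by (rule D(2)) simp
      also have "\<dots> \<le> 1" by (rule BV[OF D(1) cd])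
      finally show "(\<Sum>K\<in>p. norm (integral K g)) \<le> 1" .
    qed
    then show ?thesis by simp
  qed
  have "a \<le> a \<and> b \<le> b \<longrightarrow> negligible (N a b) \<and> g absolutely_integrable_on {a..b}"
    using \<open>a \<le> b\<close>
  \<comment> \<open>Bolzano's principle tests all small intervals around a point of {a..b},
    including those that leave {a..b}; hence the premise a \<le> c, d \<le> b inside the
    predicate.\<close>
  proof (induction rule: Bolzano[where P="\<lambda>c d. a \<le> c \<and> d \<le> b \<longrightarrow>
      negligible (N c d) \<and> g absolutely_integrable_on {c..d}"])
    case (trans x y z)
    have "{x..z} = {x..y} \<union> {y..z}" "N x z = N x y \<union> N y z"
      using trans by (auto simp: N_def)
    then show ?case
      using trans by (auto intro: absolutely_integrable_Un)
  next
    case (local x)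
    show ?case
      using \<delta>(1) local_N local_int by (intro exI[of _ \<delta>]) auto
  qed
  then have "negligible (N a b)" "g absolutely_integrable_on {a..b}" by auto
  then show "negligible {x \<in> {a..b}. \<not> f differentiable (at x)}"
    "(\<lambda>x. vector_derivative f (at x)) absolutely_integrable_on {a..b}"
    "((\<lambda>x. vector_derivative f (at x)) has_integral (f b - f a)) {a..b}"
    using int[of a b] \<open>a \<le> b\<close> by (auto simp: N_def g_def[abs_def])
qed

section \<open>Fractional integrals\<close>

text \<open>Young's inequality makes the product integrable; applied to f and g divided by their
  norms, it integrates to 1/p + 1/q = 1. A norm that vanishes cannot be divided by, but then the
  product is 0 almost everywhere.\<close>

lemma Holder_integral:
  fixes f g :: "'a \<Rightarrow> real"
  assumes pq: "p > 1" "q > 1" "1 / p + 1 / q = 1"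
    and meas[measurable]: "f \<in> borel_measurable M" "g \<in> borel_measurable M"
    and nonneg: "\<And>x. f x \<ge> 0" "\<And>x. g x \<ge> 0"
    and int: "integrable M (\<lambda>x. f x powr p)" "integrable M (\<lambda>x. g x powr q)"
  shows "integrable M (\<lambda>x. f x * g x)"
    and "(LINT x|M. f x * g x) \<le> (LINT x|M. f x powr p) powr (1 / p) * (LINT x|M. g x powr q) powr (1 / q)"
proof -
  have young: "f x * g x \<le> f x powr p / p + g x powr q / q" for x
    using Youngs_inequality[OF pq nonneg(1)[of x] nonneg(2)[of x]] .
  show fg: "integrable M (\<lambda>x. f x * g x)"
  proof (rule Bochner_Integration.integrable_bound)
    show "integrable M (\<lambda>x. f x powr p / p + g x powr q / q)" using int by auto
    show "AE x in M. norm (f x * g x) \<le> norm (f x powr p / p + g x powr q / q)"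
    proof (rule AE_I2)
      fix x
      have "0 \<le> f x * g x" using nonneg[of x] by simp
      then show "norm (f x * g x) \<le> norm (f x powr p / p + g x powr q / q)"
        using young[of x] by simp
    qed
  qed simp
  define A B where "A = (LINT x|M. f x powr p)" and "B = (LINT x|M. g x powr q)"
  have AB: "A \<ge> 0" "B \<ge> 0" by (auto simp: A_def B_def)
  have "(LINT x|M. f x * g x) \<le> A powr (1 / p) * B powr (1 / q)"
  proof (cases "A = 0 \<or> B = 0")
    case True
    have "AE x in M. f x * g x = 0"
    proof (cases "A = 0")
      case True
      then have "AE x in M. f x powr p = 0"
        using integral_nonneg_eq_0_iff_AE[OF int(1)] by (simp add: A_def)
      then show ?thesis by (auto elim!: eventually_mono)
    next
      case False
      with \<open>A = 0 \<or> B = 0\<close> have "AE x in M. g x powr q = 0"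
        using integral_nonneg_eq_0_iff_AE[OF int(2)] by (simp add: B_def)
      then show ?thesis by (auto elim!: eventually_mono)
    qed
    then have "(LINT x|M. f x * g x) = 0" by (rule integral_eq_zero_AE)
    then show ?thesis by simp
  next
    case False
    with AB have pos: "A > 0" "B > 0" by auto
    define a b where "a = A powr (1 / p)" and "b = B powr (1 / q)"
    have ab: "a > 0" "b > 0" using pos by (auto simp: a_def b_def)
    have pw: "a powr p = A" "b powr q = B" using pos pq by (auto simp: a_def b_def powr_powr)
    have "(LINT x|M. f x * g x) / (a * b) = (LINT x|M. (f x / a) * (g x / b))" by simp
    also have "\<dots> \<le> (LINT x|M. f x powr p / (p * A) + g x powr q / (q * B))"
    proof (rule integral_mono)
      show "integrable M (\<lambda>x. f x / a * (g x / b))" using fg by simp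
      show "integrable M (\<lambda>x. f x powr p / (p * A) + g x powr q / (q * B))" using int by auto
      fix x
      have "f x / a * (g x / b) \<le> (f x / a) powr p / p + (g x / b) powr q / q"
        using Youngs_inequality[OF pq, of "f x / a" "g x / b"] nonneg[of x] ab by simp
      then show "f x / a * (g x / b) \<le> f x powr p / (p * A) + g x powr q / (q * B)"
        using nonneg[of x] ab by (simp add: powr_divide pw mult.commute)
    qed
    also have "\<dots> = 1 / p + 1 / q"
      using int pos by (simp add: A_def[symmetric] B_def[symmetric])
    finally have "(LINT x|M. f x * g x) / (a * b) \<le> 1" using pq by simp
    then show ?thesis using ab by (simp add: a_def b_def field_simps)
  qed
  then show "(LINT x|M. f x * g x) \<le> (LINT x|M. f x powr p) powr (1 / p) * (LINT x|M. g x powr q) powr (1 / q)"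
    by (simp add: A_def B_def)
qed

section \<open>Borel representatives and composition of fractional integrals\<close>

text \<open>Coordinatewise from the real case. It supplies the Borel representative of u' with which
  Fubini's theorem can be applied to the product of two copies of \<open>lborel\<close>.\<close>

lemma completion_ex_borel_measurable_euclidean:
  fixes g :: "'a \<Rightarrow> 'b::euclidean_space"
  assumes g: "g \<in> borel_measurable (completion M)"
  shows "\<exists>g'\<in>borel_measurable M. AE x in M. g x = g' x"
proof -
  have "\<exists>h. \<forall>i\<in>Basis. h i \<in> borel_measurable M \<and> (AE x in M. g x \<bullet> i = h i x)"
  proof (rule bchoice, rule ballI)
    fix i :: 'b assume "i \<in> Basis"
    have "(\<lambda>x. g x \<bullet> i) \<in> borel_measurable (completion M)" using g by simp
    from completion_ex_borel_measurable_real[OF this]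
    show "\<exists>h. h \<in> borel_measurable M \<and> (AE x in M. g x \<bullet> i = h x)" by blast
  qed
  then obtain h where h: "\<And>i. i \<in> Basis \<Longrightarrow> h i \<in> borel_measurable M"
    "\<And>i. i \<in> Basis \<Longrightarrow> AE x in M. g x \<bullet> i = h i x" by blast
  have "AE x in M. \<forall>i\<in>Basis. g x \<bullet> i = h i x"
    using h(2) by (intro AE_finite_allI) auto
  then have "AE x in M. g x = (\<Sum>i\<in>Basis. h i x *\<^sub>R i)"
    by (elim eventually_mono) (simp add: euclidean_eq_iff[where 'a='b] inner_sum_left_Basis)
  moreover have "(\<lambda>x. \<Sum>i\<in>Basis. h i x *\<^sub>R i) \<in> borel_measurable M"
    using h(1) by (intro borel_measurable_sum borel_measurable_scaleR borel_measurable_const)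
  ultimately show ?thesis by (rule bexI)
qed

text \<open>
  Since \<open>0 powr x = 0\<close>, the integrands vanish at the endpoints, so it does not matter that the
  library's Beta integral is over a closed interval.
\<close>

lemma Beta_integral_interval:
  fixes s t \<alpha> :: real
  assumes \<alpha>: "0 < \<alpha>" "\<alpha> < 1" and "s < t"
  defines "k \<equiv> \<lambda>x. indicator {s<..<t} x * ((t - x) powr (\<alpha> - 1) * (x - s) powr (- \<alpha>))"
  shows "integrable lborel k" "(LINT x|lborel. k x) = Gamma \<alpha> * Gamma (1 - \<alpha>)"
proof -
  define h where "h v = indicator {0..1} v *\<^sub>R (v powr ((1 - \<alpha>) - 1) * (1 - v) powr (\<alpha> - 1))" for v :: real
  have seth: "set_integrable lborel {0..1} (\<lambda>v. v powr ((1 - \<alpha>) - 1) * (1 - v) powr (\<alpha> - 1))"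
    using integrable_Beta[of "1 - \<alpha>" \<alpha>] \<alpha> by simp
  have h: "integrable lborel h" using seth by (simp add: set_integrable_def h_def[abs_def])
  have "(LINT v|lborel. h v) = Beta (1 - \<alpha>) \<alpha>"
    using set_borel_integral_eq_integral(2)[OF seth] has_integral_Beta_real[of "1 - \<alpha>" \<alpha>] \<alpha>
    by (simp add: set_lebesgue_integral_def h_def[abs_def] integral_unique)
  also have "\<dots> = Gamma \<alpha> * Gamma (1 - \<alpha>)"
    by (simp add: Beta_def Gamma_1 mult.commute)
  finally have hB: "(LINT v|lborel. h v) = Gamma \<alpha> * Gamma (1 - \<alpha>)" .
  \<comment> \<open>Under x = s + (t - s) v the powers of t - s combine to 1 / (t - s), which
    cancels the Jacobian. This is why the integral depends on neither s nor t.\<close>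
  have kh: "k (s + (t - s) * v) = h v / (t - s)" for v
  proof (cases "0 < v \<and> v < 1")
    case True
    then have "(t - s) * v > 0" "(t - s) * v < t - s"
      using \<open>s < t\<close> mult_strict_left_mono[of v 1 "t - s"] by auto
    then have "s + (t - s) * v \<in> {s<..<t}" by (simp add: less_diff_eq add.commute)
    moreover have "t - (s + (t - s) * v) = (t - s) * (1 - v)" by (simp add: algebra_simps)
    moreover have pw: "(t - s) powr (\<alpha> - 1) * (t - s) powr (- \<alpha>) = 1 / (t - s)"
      using \<open>s < t\<close> powr_minus_divide[of "t - s" 1] by (simp add: powr_add[symmetric])
    ultimately have "k (s + (t - s) * v)
      = ((t - s) powr (\<alpha> - 1) * (t - s) powr (- \<alpha>)) * (v powr (- \<alpha>) * (1 - v) powr (\<alpha> - 1))"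
      using True \<open>s < t\<close> by (simp add: k_def powr_mult mult_ac)
    then show ?thesis
      using True pw by (simp add: h_def)
  next
    case False
    then have "h v = 0" by (auto simp: h_def indicator_def)
    moreover have "s + (t - s) * v \<notin> {s<..<t}"
    proof
      assume "s + (t - s) * v \<in> {s<..<t}"
      then have "(t - s) * v > 0" "(t - s) * v < t - s"
        unfolding greaterThanLessThan_iff by linarith+
      then have "v > 0" using \<open>s < t\<close> by (simp add: zero_less_mult_iff)
      moreover have "v < 1"
      proof (rule ccontr)
        assume "\<not> v < 1"
        then have "(t - s) * 1 \<le> (t - s) * v" using \<open>s < t\<close> by (intro mult_left_mono) auto
        with \<open>(t - s) * v < t - s\<close> show False by (metis mult_1_right not_le)
      qed
      ultimately show False using False by simp
    qed
    ultimately show ?thesis by (simp add: k_def)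
  qed
  have "integrable lborel (\<lambda>v. k (s + (t - s) * v))" unfolding kh using h by simp
  then show "integrable lborel k"
    using lborel_integrable_real_affine_iff[of "t - s" k s] \<open>s < t\<close> by simp
  show "(LINT x|lborel. k x) = Gamma \<alpha> * Gamma (1 - \<alpha>)"
    using lborel_integral_real_affine[of "t - s" k s] \<open>s < t\<close> hB unfolding kh by simp
qed

text \<open>\<open>W\<close> is \<Gamma>(1 - \<alpha>) times the fractional integral of order 1 -
  \<alpha> started at minus infinity; the lower limit a enters later through a \<open>G\<close> that
  vanishes outside (a, b). After exchanging the integrals the inner one is a Beta integral, constant
  for s < t, which leaves the ordinary integral of \<open>G\<close>.\<close>

lemma fractional_integral_composition:
  fixes G :: "real \<Rightarrow> 'b::euclidean_space"
  assumes \<alpha>: "0 < \<alpha>" "\<alpha> < 1" and G: "integrable lborel G"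
  defines "W \<equiv> \<lambda>x. LINT s|lborel. (indicator {..<x} s * (x - s) powr (- \<alpha>)) *\<^sub>R G s"
  shows "W \<in> borel_measurable lborel"
    and "integrable lborel (\<lambda>x. (indicator {..<t} x * (t - x) powr (\<alpha> - 1)) *\<^sub>R W x)"
    and "(LINT x|lborel. (indicator {..<t} x * (t - x) powr (\<alpha> - 1)) *\<^sub>R W x)
      = (Gamma \<alpha> * Gamma (1 - \<alpha>)) *\<^sub>R (LINT s|lborel. indicator {..<t} s *\<^sub>R G s)"
proof -
  define C where "C = Gamma \<alpha> * Gamma (1 - \<alpha>)"
  have Gm[measurable]: "G \<in> borel_measurable borel" using borel_measurable_integrable[OF G] by simp
  define k where "k s x = indicator {s<..<t} x * ((t - x) powr (\<alpha> - 1) * (x - s) powr (- \<alpha>))"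
    for s x :: real
  define H where "H s x = k s x *\<^sub>R G s" for s x
  have k0: "k s x = 0" if "t \<le> s" for s x using that by (auto simp: k_def indicator_def)
  have kpos: "k s x \<ge> 0" for s x by (simp add: k_def)
  have "integrable lborel (k s) \<and> (LINT x|lborel. k s x) = C * indicator {..<t} s" for s
  proof (cases "s < t")
    case True
    then show ?thesis
      using Beta_integral_interval[OF \<alpha> True] by (simp add: k_def[abs_def] C_def)
  next
    case False
    then have "k s = (\<lambda>_. 0)" using k0 by fastforce
    with False show ?thesis by simp
  qed
  then have kint: "integrable lborel (k s)" "(LINT x|lborel. k s x) = C * indicator {..<t} s" for s
    by auto
  have km[measurable]: "case_prod k \<in> borel_measurable (lborel \<Otimes>\<^sub>M lborel)"
  proof -
    have "case_prod k = (\<lambda>z. if fst z < snd z \<and> snd z < t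
        then (t - snd z) powr (\<alpha> - 1) * (snd z - fst z) powr (- \<alpha>) else 0)"
      by (auto simp: k_def fun_eq_iff indicator_def)
    also have "\<dots> \<in> borel_measurable (lborel \<Otimes>\<^sub>M lborel)" by measurable
    finally show ?thesis .
  qed
  have Hm: "case_prod H \<in> borel_measurable (lborel \<Otimes>\<^sub>M lborel)"
  proof -
    have "case_prod H = (\<lambda>z. case_prod k z *\<^sub>R G (fst z))" by (auto simp: H_def fun_eq_iff)
    also have "\<dots> \<in> borel_measurable (lborel \<Otimes>\<^sub>M lborel)" by measurable
    finally show ?thesis .
  qed
  have Hint: "integrable (lborel \<Otimes>\<^sub>M lborel) (case_prod H)"
  proof (rule lborel_pair.Fubini_integrable[OF Hm])
    \<comment> \<open>As \<open>k\<close> is nonnegative, the Beta integral also evaluates the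
      integral of the norm, and integrability of \<open>G\<close> closes the Fubini
      condition.\<close>
    have "(LINT x|lborel. norm (case_prod H (s, x))) = C * indicator {..<t} s * norm (G s)" for s
      using kint[of s] kpos by (simp add: H_def)
    moreover have "integrable lborel (\<lambda>s. C * indicator {..<t} s * norm (G s))"
      using integrable_mult_indicator[of "{..<t}" lborel "\<lambda>s. norm (G s)"] G
      by (simp add: mult.assoc)
    ultimately show "integrable lborel (\<lambda>s. LINT x|lborel. norm (case_prod H (s, x)))" by simp
    show "AE s in lborel. integrable lborel (\<lambda>x. case_prod H (s, x))"
      using kint(1) by (auto simp: H_def)
  qed
  have inner: "(LINT s|lborel. H s x) = (indicator {..<t} x * (t - x) powr (\<alpha> - 1)) *\<^sub>R W x" for x
  proof -
    have "H s x = (indicator {..<t} x * (t - x) powr (\<alpha> - 1)) *\<^sub>R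
        ((indicator {..<x} s * (x - s) powr (- \<alpha>)) *\<^sub>R G s)" for s
      by (auto simp: H_def k_def indicator_def)
    then show ?thesis unfolding W_def by (simp only: integral_scaleR_right)
  qed
  show "integrable lborel (\<lambda>x. (indicator {..<t} x * (t - x) powr (\<alpha> - 1)) *\<^sub>R W x)"
    using lborel_pair.integrable_snd[OF Hint] unfolding inner .
  have "(LINT x|lborel. (indicator {..<t} x * (t - x) powr (\<alpha> - 1)) *\<^sub>R W x)
    = (LINT s|lborel. LINT x|lborel. H s x)"
    using lborel_pair.Fubini_integral[OF Hint] unfolding inner .
  also have "\<dots> = (LINT s|lborel. C *\<^sub>R (indicator {..<t} s *\<^sub>R G s))"
    using kint by (intro Bochner_Integration.integral_cong) (auto simp: H_def)
  finally show "(LINT x|lborel. (indicator {..<t} x * (t - x) powr (\<alpha> - 1)) *\<^sub>R W x)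
      = (Gamma \<alpha> * Gamma (1 - \<alpha>)) *\<^sub>R (LINT s|lborel. indicator {..<t} s *\<^sub>R G s)"
    unfolding integral_scaleR_right C_def .
  have "(\<lambda>z. (if snd z < fst z then (fst z - snd z) powr (- \<alpha>) else 0) *\<^sub>R G (snd z))
    \<in> borel_measurable (lborel \<Otimes>\<^sub>M lborel)" by measurable
  also have "(\<lambda>z. (if snd z < fst z then (fst z - snd z) powr (- \<alpha>) else 0) *\<^sub>R G (snd z))
    = (\<lambda>(x, s). (indicator {..<x} s * (x - s) powr (- \<alpha>)) *\<^sub>R G s)"
    by (auto simp: fun_eq_iff indicator_def)
  finally show "W \<in> borel_measurable lborel"
    unfolding W_def by (rule lborel.borel_measurable_lebesgue_integral)
qed

section \<open>Pointwise bounds by the Caputo derivative\<close>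

text \<open>The primitive -(t - x)^c / c is continuous up to x = t even if the kernel is singular
  there, so the fundamental theorem with derivatives in the interior suffices.\<close>

lemma has_integral_powr_kernel:
  fixes a t c :: real
  assumes "c > 0" "a \<le> t"
  shows "((\<lambda>x. (t - x) powr (c - 1)) has_integral ((t - a) powr c / c)) {a..t}"
proof -
  have "((\<lambda>x. (t - x) powr (c - 1)) has_integral (- ((t - t) powr c / c) - (- ((t - a) powr c / c)))) {a..t}"
  proof (rule fundamental_theorem_of_calculus_interior[OF assms(2)])
    show "continuous_on {a..t} (\<lambda>x. - ((t - x) powr c / c))"
      using \<open>c > 0\<close> by (intro continuous_intros continuous_on_powr') auto
    fix x assume "x \<in> {a<..<t}"
    then have "((\<lambda>x. - ((t - x) powr c / c)) has_real_derivative (t - x) powr (c - 1)) (at x)"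
      using \<open>c > 0\<close> by (auto intro!: derivative_eq_intros simp: powr_diff)
    then show "((\<lambda>x. - ((t - x) powr c / c)) has_vector_derivative (t - x) powr (c - 1)) (at x)"
      by (simp add: has_real_derivative_iff_has_vector_derivative)
  qed
  then show ?thesis by simp
qed

lemma LINT_lebesgue_on:
  fixes f :: "real \<Rightarrow> 'b::{banach, second_countable_topology}"
  assumes "S \<in> sets lebesgue"
  shows "(LINT x|lebesgue_on S. f x) = (LINT x|lebesgue. indicator S x *\<^sub>R f x)"
  using assms by (simp add: integral_restrict_space)

text \<open>The representation of u by its Caputo derivative, after taking norms. The integral runs
  over all of {a<..<b}, with an indicator cutting it off at t, so that Hoelder's inequality acts on
  the measure space of the Lp norm.\<close>

lemma Gamma_norm_le_caputo_integral:
  fixes u :: "real \<Rightarrow> 'b::euclidean_space"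
  assumes \<alpha>: "0 < \<alpha>" "\<alpha> \<le> 1" and AC: "absolutely_continuous_fun_on a b u" and "u a = 0"
    and t: "a < t" "t < b"
  shows "Gamma \<alpha> * norm (u t) \<le> (LINT x|lebesgue_on {a<..<b}.
    (indicator {a<..<t} x * (t - x) powr (\<alpha> - 1)) * norm (caputo_deriv a \<alpha> u x))"
proof -
  define v where "v s = vector_derivative u (at s)" for s
  note FTC = absolutely_continuous_vector_derivative[OF absolutely_continuous_fun_on_subinterval[OF AC],
      folded v_def]
  have set_int: "set_integrable lebesgue {a<..<b} v" "set_integrable lebesgue {a<..<t} v"
    using FTC(2)[of a b] FTC(2)[of a t] t by (auto simp: absolutely_integrable_on_Icc_iff_Ioo)
  have ut: "(LINT s:{a<..<t}|lebesgue. v s) = u t"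
    using set_lebesgue_integral_eq_integral(2)[OF set_int(2)] FTC(3)[of a t] t \<open>u a = 0\<close>
    by (simp add: has_integral_Icc_iff_Ioo integral_unique)
  show ?thesis
  \<comment> \<open>At order 1 the Caputo derivative is u' itself, through the first branch of
    \<open>RL_integral\<close>, and the composition formula does not cover this order.\<close>
  proof (cases "\<alpha> = 1")
    case True
    have "caputo_deriv a \<alpha> u = v"
      using True by (simp add: caputo_deriv_def RL_integral_def v_def fun_eq_iff)
    moreover have "norm (u t) \<le> (LINT s:{a<..<t}|lebesgue. norm (v s))"
      using set_integral_norm_bound[OF set_int(2)] ut by simp
    moreover have "(LINT x|lebesgue_on {a<..<b}. (indicator {a<..<t} x * (t - x) powr (\<alpha> - 1)) * norm (v x))
      = (LINT s:{a<..<t}|lebesgue. norm (v s))"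
      unfolding set_lebesgue_integral_def using True t
      by (subst LINT_lebesgue_on) (auto intro!: Bochner_Integration.integral_cong simp: indicator_def)
    ultimately show ?thesis using True by simp
  next
    case False
    with \<alpha> have "\<alpha> < 1" by simp
    define w where "w = caputo_deriv a \<alpha> u"
    \<comment> \<open>Extension by zero lets integrals over all s < x replace integrals from a to
      x.\<close>
    define G0 where "G0 s = indicator {a<..<b} s *\<^sub>R v s" for s
    have G0: "integrable lebesgue G0"
      using set_int(1) by (simp add: set_integrable_def G0_def[abs_def])
    obtain G where G[measurable]: "G \<in> borel_measurable lborel" and AE_G: "AE s in lborel. G0 s = G s"
      using completion_ex_borel_measurable_euclidean[OF borel_measurable_integrable[OF G0]] by blast
    have AE_G': "AE s in lebesgue. G0 s = G s" using AE_completion[OF AE_G] .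
    have Gm: "G \<in> borel_measurable lebesgue" using measurable_completion[OF G] .
    have "integrable lebesgue G"
      using G0 integrable_cong_AE[OF borel_measurable_integrable[OF G0] Gm AE_G'] by simp
    then have Gint: "integrable lborel G" using integrable_completion[OF G] by simp
    \<comment> \<open>\<open>G\<close> and \<open>G0\<close> differ on a null set only, so no
      integral against a Borel weight changes when one replaces the other or \<open>lborel\<close>
      its completion.\<close>
    have transfer: "(LINT s|lborel. \<kappa> s *\<^sub>R G s) = (LINT s|lebesgue. \<kappa> s *\<^sub>R G0 s)"
      if [measurable]: "\<kappa> \<in> borel_measurable borel" for \<kappa> :: "real \<Rightarrow> real"
    proof -
      have m: "(\<lambda>s. \<kappa> s *\<^sub>R G s) \<in> borel_measurable lborel" by measurable
      have \<kappa>m: "\<kappa> \<in> borel_measurable lebesgue" by (rule measurable_completion) simp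
      have "(LINT s|lborel. \<kappa> s *\<^sub>R G s) = (LINT s|lebesgue. \<kappa> s *\<^sub>R G s)"
        using integral_completion[OF m] by simp
      also have "\<dots> = (LINT s|lebesgue. \<kappa> s *\<^sub>R G0 s)"
      proof (rule integral_cong_AE)
        show "(\<lambda>s. \<kappa> s *\<^sub>R G s) \<in> borel_measurable lebesgue" using measurable_completion[OF m] .
        show "(\<lambda>s. \<kappa> s *\<^sub>R G0 s) \<in> borel_measurable lebesgue"
          using \<kappa>m borel_measurable_integrable[OF G0] by (rule borel_measurable_scaleR)
        show "AE s in lebesgue. \<kappa> s *\<^sub>R G s = \<kappa> s *\<^sub>R G0 s" using AE_G' by eventually_elim simp
      qed
      finally show ?thesis .
    qed
    define W where "W x = (LINT s|lborel. (indicator {..<x} s * (x - s) powr (- \<alpha>)) *\<^sub>R G s)" for x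
    note comp = fractional_integral_composition[OF \<alpha>(1) \<open>\<alpha> < 1\<close> Gint, folded W_def]
    have [measurable]: "W \<in> borel_measurable borel" using comp(1) by simp
    have W: "W x = (LINT s|lebesgue. (indicator {..<x} s * (x - s) powr (- \<alpha>)) *\<^sub>R G0 s)" for x
      unfolding W_def by (rule transfer) measurable
    \<comment> \<open>Valid at every point of (a, b): where the fractional integral does not
      converge, both sides are the default 0.\<close>
    have Ww: "W x = Gamma (1 - \<alpha>) *\<^sub>R w x" if "a < x" "x < b" for x
    proof -
      have "W x = (LINT s|lebesgue. indicator {a<..<x} s *\<^sub>R ((x - s) powr (- \<alpha>) *\<^sub>R v s))"
        unfolding W using that
        by (intro Bochner_Integration.integral_cong) (auto simp: G0_def indicator_def)
      also have "\<dots> = (LINT s|lebesgue_on {a<..<x}. (x - s) powr (- \<alpha>) *\<^sub>R v s)"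
        by (subst LINT_lebesgue_on) auto
      moreover have "Gamma (1 - \<alpha>) \<noteq> 0"
        using \<open>\<alpha> < 1\<close> Gamma_real_pos[of "1 - \<alpha>"] by linarith
      ultimately show ?thesis
        using \<open>\<alpha> < 1\<close> by (simp add: w_def caputo_deriv_def RL_integral_def v_def)
    qed
    have W0: "W x = 0" if "x \<le> a" for x
    proof -
      have zero: "(indicator {..<x} s * (x - s) powr (- \<alpha>)) *\<^sub>R G0 s = 0" for s
        using that by (auto simp: G0_def indicator_def)
      show ?thesis by (simp only: W zero Bochner_Integration.integral_zero)
    qed
    have "(LINT s|lborel. indicator {..<t} s *\<^sub>R G s) = (LINT s|lebesgue. indicator {..<t} s *\<^sub>R G0 s)"
      by (rule transfer) measurable
    also have "\<dots> = (LINT s:{a<..<t}|lebesgue. v s)"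
      unfolding set_lebesgue_integral_def using t
      by (intro Bochner_Integration.integral_cong) (auto simp: G0_def indicator_def)
    finally have "(Gamma \<alpha> * Gamma (1 - \<alpha>)) *\<^sub>R u t
      = (LINT x|lborel. (indicator {..<t} x * (t - x) powr (\<alpha> - 1)) *\<^sub>R W x)"
      using comp(3) ut by simp
    then have "norm ((Gamma \<alpha> * Gamma (1 - \<alpha>)) *\<^sub>R u t)
      \<le> (LINT x|lborel. norm ((indicator {..<t} x * (t - x) powr (\<alpha> - 1)) *\<^sub>R W x))"
      by (simp only: integral_norm_bound)
    also have "\<dots> = (LINT x|lebesgue. norm ((indicator {..<t} x * (t - x) powr (\<alpha> - 1)) *\<^sub>R W x))"
      by (intro integral_completion[symmetric]) measurable
    also have "\<dots> = (LINT x|lebesgue. Gamma (1 - \<alpha>) * (indicator {a<..<b} x *\<^sub>R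
      ((indicator {a<..<t} x * (t - x) powr (\<alpha> - 1)) * norm (w x))))"
    proof (rule Bochner_Integration.integral_cong)
      fix x
      show "norm ((indicator {..<t} x * (t - x) powr (\<alpha> - 1)) *\<^sub>R W x)
        = Gamma (1 - \<alpha>) * (indicator {a<..<b} x *\<^sub>R
          ((indicator {a<..<t} x * (t - x) powr (\<alpha> - 1)) * norm (w x)))"
        using W0[of x] Ww[of x] t Gamma_real_pos[of "1 - \<alpha>"] \<open>\<alpha> < 1\<close>
        by (cases "x \<le> a") (auto simp: indicator_def)
    qed simp
    also have "\<dots> = Gamma (1 - \<alpha>) * (LINT x|lebesgue_on {a<..<b}.
      (indicator {a<..<t} x * (t - x) powr (\<alpha> - 1)) * norm (w x))"
      by (subst LINT_lebesgue_on) auto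
    finally have "Gamma (1 - \<alpha>) * (Gamma \<alpha> * norm (u t)) \<le> Gamma (1 - \<alpha>) * (LINT x|lebesgue_on {a<..<b}.
      (indicator {a<..<t} x * (t - x) powr (\<alpha> - 1)) * norm (w x))"
      using Gamma_real_pos[of "1 - \<alpha>"] Gamma_real_pos[of \<alpha>] \<alpha>(1) \<open>\<alpha> < 1\<close> by (simp add: abs_mult mult_ac)
    then show ?thesis
      using Gamma_real_pos[of "1 - \<alpha>"] \<open>\<alpha> < 1\<close> by (simp add: w_def mult_le_cancel_left_pos)
  qed
qed

text \<open>Hoelder's inequality with q = p / (p - 1) leaves the q-th power of the kernel, (t -
  x)^(c - 1), where c is the bracket in the constant. It is integrable exactly when c > 0, that is
  when \<alpha> p > 1.\<close>

lemma norm_le_Lp_norm_caputo_deriv: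
  fixes u :: "real \<Rightarrow> 'b::euclidean_space"
  assumes p: "1 < p" and \<alpha>: "1 / p < \<alpha>" "\<alpha> \<le> 1"
    and AC: "absolutely_continuous_fun_on a b u" and "u a = 0"
    and Lp: "in_Lp p {a<..<b} (caputo_deriv a \<alpha> u)" and t: "a < t" "t < b"
  shows "norm (u t) \<le> (t - a) powr (\<alpha> - 1 / p)
    / ((\<alpha> * p / (p - 1) - 1 / (p - 1)) powr ((p - 1) / p) * Gamma \<alpha>)
    * Lp_norm p {a<..<b} (caputo_deriv a \<alpha> u)"
proof -
  have "1 / p > 0" using p by simp
  then have "\<alpha> > 0" using \<alpha> by linarith
  define w where "w = caputo_deriv a \<alpha> u"
  define q where "q = p / (p - 1)"
  define c where "c = \<alpha> * p / (p - 1) - 1 / (p - 1)"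
  define F where "F x = indicator {a<..<t} x * (t - x) powr (\<alpha> - 1)" for x
  have q: "q > 1" "1 / p + 1 / q = 1" "1 / q = (p - 1) / p"
    using p by (auto simp: q_def field_simps)
  have "\<alpha> * p > 1" using \<alpha>(1) p by (simp add: field_simps)
  have c: "c = (\<alpha> * p - 1) / (p - 1)" by (simp add: c_def diff_divide_distrib)
  then have "c > 0" using p \<open>\<alpha> * p > 1\<close> by simp
  \<comment> \<open>The first equation says c = (\<alpha> - 1) q + 1; the second is the exponent of
    t - a that remains after the q-th root.\<close>
  have cq: "(\<alpha> - 1) * q = c - 1" "c * ((p - 1) / p) = \<alpha> - 1 / p"
    using p by (simp_all add: q_def c field_simps)
  have Fq: "F x powr q = indicator {a<..<t} x *\<^sub>R (t - x) powr (c - 1)" for x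
    by (auto simp: F_def indicator_def powr_powr cq)
  have ker: "((\<lambda>x. (t - x) powr (c - 1)) has_integral ((t - a) powr c / c)) {a<..<t}"
    using has_integral_powr_kernel[OF \<open>c > 0\<close>, of a t] t by (simp add: has_integral_Icc_iff_Ioo)
  then have "set_integrable lebesgue {a<..<t} (\<lambda>x. (t - x) powr (c - 1))"
    by (intro nonnegative_absolutely_integrable_1) auto
  note ker_int = this and ker_eq = set_lebesgue_integral_eq_integral(2)[OF this]
  have ab: "indicator {a<..<b} x * (indicator {a<..<t} x * y) = indicator {a<..<t} x * y" for x y :: real
    using t by (auto simp: indicator_def)
  have Fq_int: "integrable (lebesgue_on {a<..<b}) (\<lambda>x. F x powr q)"
    by (subst integrable_restrict_space)
      (use ker_int in \<open>simp_all add: ab Fq set_integrable_def\<close>)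
  have Fq_eq: "(LINT x|lebesgue_on {a<..<b}. F x powr q) = (t - a) powr c / c"
    by (subst LINT_lebesgue_on)
      (use ker_eq ker in \<open>simp_all add: ab Fq set_lebesgue_integral_def integral_unique\<close>)
  have "F \<in> borel_measurable lebesgue"
    unfolding F_def by (intro measurable_completion) measurable
  then have Fm: "F \<in> borel_measurable (lebesgue_on {a<..<b})" by (rule measurable_restrict_space1)
  have wm: "w \<in> borel_measurable (lebesgue_on {a<..<b})"
    and wp: "integrable (lebesgue_on {a<..<b}) (\<lambda>x. norm (w x) powr p)"
    using Lp by (auto simp: in_Lp_def w_def)
  have "Gamma \<alpha> * norm (u t) \<le> (LINT x|lebesgue_on {a<..<b}. F x * norm (w x))"
    using Gamma_norm_le_caputo_integral[OF \<open>\<alpha> > 0\<close> \<alpha>(2) AC \<open>u a = 0\<close> t] by (simp add: F_def w_def)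
  also have "\<dots> \<le> (LINT x|lebesgue_on {a<..<b}. F x powr q) powr (1 / q)
      * (LINT x|lebesgue_on {a<..<b}. norm (w x) powr p) powr (1 / p)"
  proof (rule Holder_integral(2))
    show "1 / q + 1 / p = 1" using q(2) by simp
    show "F x \<ge> 0" for x by (simp add: F_def)
  qed (use p q(1) Fm wm Fq_int wp in auto)
  also have "\<dots> = ((t - a) powr c / c) powr (1 / q) * Lp_norm p {a<..<b} w"
    by (simp add: Fq_eq Lp_norm_def)
  also have "((t - a) powr c / c) powr (1 / q) = (t - a) powr (\<alpha> - 1 / p) / c powr ((p - 1) / p)"
    using \<open>c > 0\<close> t by (simp only: powr_divide powr_ge_zero less_imp_le powr_powr cq q(3))
  finally have "Gamma \<alpha> * norm (u t)
    \<le> (t - a) powr (\<alpha> - 1 / p) / c powr ((p - 1) / p) * Lp_norm p {a<..<b} w" .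
  then have "norm (u t) * Gamma \<alpha>
    \<le> (t - a) powr (\<alpha> - 1 / p) / c powr ((p - 1) / p) * Lp_norm p {a<..<b} w"
    by (subst mult.commute)
  then have "norm (u t) \<le> (t - a) powr (\<alpha> - 1 / p) / c powr ((p - 1) / p) * Lp_norm p {a<..<b} w / Gamma \<alpha>"
    by (rule mult_imp_le_div_pos[OF Gamma_real_pos[OF \<open>\<alpha> > 0\<close>]])
  then show ?thesis by (simp add: w_def c_def)
qed

section \<open>The weighted estimate\<close>

theorem theorem3p7:
  fixes a b p \<alpha> :: real
    and u :: "real \<Rightarrow> 'a::{real_normed_field, euclidean_space}"
  assumes "0 < a" and "a < b"
    and "1 < p"
    and "1 / p < \<alpha>" and "\<alpha> \<le> 1"
    and "absolutely_continuous_fun_on a b u"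
    and "u a = 0"
    and "in_Lp p {a<..<b} (caputo_deriv a \<alpha> u)"
  shows "in_Lp p {a<..<b} (\<lambda>x. u x / of_real x) \<and>
    Lp_norm p {a<..<b} (\<lambda>x. u x / of_real x)
      \<le> inverse a * (b - a) powr \<alpha>
          / ((\<alpha> * p / (p - 1) - 1 / (p - 1)) powr ((p - 1) / p) * Gamma \<alpha>)
        * Lp_norm p {a<..<b} (caputo_deriv a \<alpha> u)"
proof -
  have "1 / p > 0" using assms(3) by simp
  then have "\<alpha> > 0" using assms(4) by linarith
  define C where "C = (\<alpha> * p / (p - 1) - 1 / (p - 1)) powr ((p - 1) / p) * Gamma \<alpha>"
  define L where "L = Lp_norm p {a<..<b} (caputo_deriv a \<alpha> u)"
  \<comment> \<open>A uniform bound for u(x) / x on (a, b): the increasing power (x - a)^(\<alpha> -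
    1/p) is replaced by its value at b.\<close>
  define M where "M = inverse a * ((b - a) powr (\<alpha> - 1 / p) / C * L)"
  define f where "f x = u x / of_real x" for x
  have "C \<ge> 0" using Gamma_real_pos[OF \<open>\<alpha> > 0\<close>] by (simp add: C_def)
  have "L \<ge> 0" by (simp add: L_def Lp_norm_def)
  have "M \<ge> 0" using \<open>C \<ge> 0\<close> \<open>L \<ge> 0\<close> assms(1) by (simp add: M_def)
  have bound: "norm (f x) \<le> M" if x: "x \<in> {a<..<b}" for x
  proof -
    have "norm (u x) \<le> (x - a) powr (\<alpha> - 1 / p) / C * L"
      using norm_le_Lp_norm_caputo_deriv[OF assms(3-8)] x by (simp add: C_def L_def)
    also have "\<dots> \<le> (b - a) powr (\<alpha> - 1 / p) / C * L"
      using x assms(4) \<open>C \<ge> 0\<close> \<open>L \<ge> 0\<close>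
      by (intro mult_right_mono divide_right_mono powr_mono2) auto
    finally have "norm (u x) \<le> (b - a) powr (\<alpha> - 1 / p) / C * L" .
    moreover have "inverse x \<le> inverse a" using x assms(1) by (simp add: le_imp_inverse_le)
    ultimately have "inverse x * norm (u x) \<le> M"
      unfolding M_def using x assms(1) by (intro mult_mono) auto
    moreover have "norm (f x) = inverse x * norm (u x)"
      using x assms(1) by (simp add: f_def norm_divide inverse_eq_divide)
    ultimately show ?thesis by simp
  qed
  have "continuous_on {a<..<b} u"
    using absolutely_continuous_fun_on_imp_continuous_on[OF assms(6)]
    by (rule continuous_on_subset) auto
  then have "continuous_on {a<..<b} f"
    unfolding f_def using assms(1) by (intro continuous_intros) auto
  then have fm: "f \<in> borel_measurable (lebesgue_on {a<..<b})"
    by (rule continuous_imp_measurable_on_sets_lebesgue) simp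
  interpret finite_measure "lebesgue_on {a<..<b}"
    using assms(2) by (intro finite_measureI) (simp add: emeasure_restrict_space)
  have bound_p: "norm (f x) powr p \<le> M powr p" if "x \<in> {a<..<b}" for x
    using bound[OF that] assms(3) by (intro powr_mono2) auto
  have fp: "integrable (lebesgue_on {a<..<b}) (\<lambda>x. norm (f x) powr p)"
  proof (rule integrable_const_bound)
    show "AE x in lebesgue_on {a<..<b}. norm (norm (f x) powr p) \<le> M powr p"
      using bound_p by (intro AE_I2) (simp add: space_restrict_space)
    show "(\<lambda>x. norm (f x) powr p) \<in> borel_measurable (lebesgue_on {a<..<b})"
      using fm by measurable
  qed
  have "(LINT x|lebesgue_on {a<..<b}. norm (f x) powr p) \<le> (LINT x|lebesgue_on {a<..<b}. M powr p)"
    using bound_p fp by (intro integral_mono) (auto simp: space_restrict_space)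
  also have "\<dots> = M powr p * (b - a)"
    using assms(2) by (simp add: measure_restrict_space space_restrict_space)
  finally have "Lp_norm p {a<..<b} f \<le> (M powr p * (b - a)) powr (1 / p)"
    unfolding Lp_norm_def using assms(3) by (intro powr_mono2) auto
  \<comment> \<open>The Lp norm of the constant \<open>M\<close> brings the factor (b - a)^(1/p),
    which raises the exponent \<alpha> - 1/p to \<alpha>.\<close>
  also have "\<dots> = M * (b - a) powr (1 / p)"
    using assms(2,3) \<open>M \<ge> 0\<close> by (simp add: powr_mult powr_powr)
  also have "\<dots> = inverse a * ((b - a) powr (\<alpha> - 1 / p) * (b - a) powr (1 / p)) / C * L"
    by (simp add: M_def)
  also have "(b - a) powr (\<alpha> - 1 / p) * (b - a) powr (1 / p) = (b - a) powr \<alpha>"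
    by (simp add: powr_add[symmetric])
  finally show ?thesis
    using fm fp by (simp add: in_Lp_def f_def[abs_def] C_def L_def)
qed

end
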